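(* Let $\mathfrak{A}$ be a $2$-category and let $(\mathcal{A},\mathfrak{a}):\Delta_3\to\mathfrak{A}$ be a pseudofunctor that has a lax descent object. Then the forgetful morphism $\mathsf{d}^{\mathcal{A}}:\mathrm{lax}\text{-}\mathrm{Desc}(\mathcal{A})\to\mathcal{A}(\mathsf{1})$ creates absolute Kan extensions. Consequently, if a morphism $F$ of $\mathfrak{A}$ is equal to $\mathsf{d}^{\mathcal{A}}$ composed with an equivalence (that is, $F=E\circ\mathsf{d}^{\mathcal{A}}$ or $F=\mathsf{d}^{\mathcal{A}}\circ E$ for some equivalence $E$ of $\mathfrak{A}$), then $F$ creates absolute Kan extensions.
   Context: Conventions: a $2$-category is a $\mathrm{Cat}$-enriched category; "morphism" means $1$-cell; $\cdot$ denotes composition of $1$-cells and vertical composition of $2$-cells; $*$ denotes horizontal composition (whiskering). The category $\Delta_3$: the subcategory of the category of finite nonempty ordinals and order-preserving maps with objects $\mathsf{1},\mathsf{2},\mathsf{3}$ generated by the maps $d^0,d^1:\mathsf{1}\to\mathsf{2}$, $s^0:\mathsf{2}\to\mathsf{1}$, $D^0,D^1,D^2:\mathsf{2}\to\mathsf{3}$ (the usual cofaces, $d^i$ and $D^i$ omitting $i$ from the image, and codegeneracy), subject to $s^0d^1=\mathrm{id}_{\mathsf{1}}=s^0d^0$ and $D^td^k=D^kd^{t-1}$ for $t>k$. A pseudofunctor $(\mathcal{A},\mathfrak{a}):\Delta_3\to\mathfrak{A}$ has invertible $2$-cells $\mathfrak{a}_{hg}:\mathcal{A}(h)\mathcal{A}(g)\Rightarrow\mathcal{A}(hg)$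 and $\mathfrak{a}_x:\mathrm{id}_{\mathcal{A}(x)}\Rightarrow\mathcal{A}(\mathrm{id}_x)$ satisfying the usual associativity and identity coherence equations. Put $\mathcal{A}(\sigma_{01})=\mathfrak{a}_{D^0d^0}^{-1}\cdot\mathfrak{a}_{D^1d^0}$, $\mathcal{A}(\sigma_{02})=\mathfrak{a}_{D^0d^1}^{-1}\cdot\mathfrak{a}_{D^2d^0}$, $\mathcal{A}(\sigma_{12})=\mathfrak{a}_{D^1d^1}^{-1}\cdot\mathfrak{a}_{D^2d^1}$, $\mathcal{A}(\mathfrak{n}_0)=\mathfrak{a}_{\mathsf{1}}^{-1}\cdot\mathfrak{a}_{s^0d^0}$, $\mathcal{A}(\mathfrak{n}_1)=\mathfrak{a}_{\mathsf{1}}^{-1}\cdot\mathfrak{a}_{s^0d^1}$. Descent data: for a morphism $F:\mathtt{S}\to\mathcal{A}(\mathsf{1})$, an $\mathcal{A}$-descent datum for $F$ is a $2$-cell $\beta:\mathcal{A}(d^1)F\Rightarrow\mathcal{A}(d^0)F$ such that $(\mathcal{A}(\sigma_{01})*F)\cdot(\mathcal{A}(D^1)*\beta)\cdot(\mathcal{A}(\sigma_{12})*F)=(\mathcal{A}(D^0)*\beta)\cdot(\mathcal{A}(\sigma_{02})*F)\cdot(\mathcal{A}(D^2)*\beta)$ and $(\mathcal{A}(\mathfrak{n}_0)*F)\cdot(\mathcal{A}(s^0)*\beta)\cdot(\mathcal{A}(\mathfrak{n}_1)^{-1}*F)=\mathrm{id}_F$. Lax descent object: an object $\mathrm{lax}\text{-}\mathrm{Desc}(\mathcal{A})$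 with a morphism $\mathsf{d}^{\mathcal{A}}:\mathrm{lax}\text{-}\mathrm{Desc}(\mathcal{A})\to\mathcal{A}(\mathsf{1})$ (the forgetful morphism) and an $\mathcal{A}$-descent datum $\psi:\mathcal{A}(d^1)\mathsf{d}^{\mathcal{A}}\Rightarrow\mathcal{A}(d^0)\mathsf{d}^{\mathcal{A}}$ for $\mathsf{d}^{\mathcal{A}}$ such that: (1) for each $F:\mathtt{S}\to\mathcal{A}(\mathsf{1})$ and each $\mathcal{A}$-descent datum $\beta$ for $F$ there is a unique $\check F:\mathtt{S}\to\mathrm{lax}\text{-}\mathrm{Desc}(\mathcal{A})$ with $\mathsf{d}^{\mathcal{A}}\check F=F$ and $\psi*\check F=\beta$; (2) for all $F_1',F_0':\mathtt{S}\to\mathrm{lax}\text{-}\mathrm{Desc}(\mathcal{A})$ and each $2$-cell $\xi:\mathsf{d}^{\mathcal{A}}F_1'\Rightarrow\mathsf{d}^{\mathcal{A}}F_0'$ with $(\psi*F_0')\cdot(\mathcal{A}(d^1)*\xi)=(\mathcal{A}(d^0)*\xi)\cdot(\psi*F_1')$, there is a unique $2$-cell $\xi':F_1'\Rightarrow F_0'$ with $\mathsf{d}^{\mathcal{A}}*\xi'=\xi$. Kan extensions: for $J:\mathtt{S}\to\mathtt{C}$ and $H:\mathtt{S}\to\mathtt{B}$ in $\mathfrak{A}$, the right Kan extension of $J$ along $H$ is, if it exists, a pair $(\mathrm{Ran}_HJ:\mathtt{B}\to\mathtt{C},\ \gamma:(\mathrm{Ran}_HJ)H\Rightarrow J)$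 such that for every $R:\mathtt{B}\to\mathtt{C}$ the map $\beta\mapsto\gamma\cdot(\beta*H)$ is a bijection from $2$-cells $R\Rightarrow\mathrm{Ran}_HJ$ to $2$-cells $RH\Rightarrow J$. A morphism $G:\mathtt{C}\to\mathtt{D}$ preserves $(\hat J,\gamma)=\mathrm{Ran}_HJ$ if $(G\hat J,G*\gamma)$ is the right Kan extension of $GJ$ along $H$. $G$ reflects the right Kan extension of $J$ along $H$ if, whenever $(G\hat J,G*\gamma)$ is the right Kan extension of $GJ$ along $H$, $(\hat J,\gamma)$ is the right Kan extension of $J$ along $H$. Assuming $\mathrm{Ran}_HGJ$ exists, $G$ creates the right Kan extension of $GJ$ along $H$ if $G$ reflects it and $\mathrm{Ran}_HJ$ exists and is preserved by $G$. Left Kan extensions $\mathrm{Lan}_HJ$, and their preservation, reflection and creation, are defined codually (reversing $2$-cells). Absolute Kan extensions: a right Kan extension $\mathrm{Ran}_HJ$ is absolute if it is preserved by every morphism whose domain is the codomain of $\mathrm{Ran}_HJ$. $G$ creates absolute right Kan extensions if, whenever $\mathrm{Ran}_HGJ$ is an absolute right Kan extension, $G$ creates it; similarly for left Kan extensions. $G$ creates absolute Kan extensions if it creates both absolute right and absolute left Kan extensions. *)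

theory Defs
  imports Main
begin

section \<open>Categories and 2-categories\<close>

text \<open>Composition is written in the applicative order: \<open>g \<odot> f\<close> is \<open>g\<close> after \<open>f\<close>,
  and likewise for the vertical composition \<open>\<cdot>\<close> and the horizontal composition \<open>\<star>\<close> of
  2-cells.\<close>

record ('x, 'f) precat =
  Ob :: "'x set"
  Mor :: "'f set"
  Dom :: "'f \<Rightarrow> 'x"
  Cod :: "'f \<Rightarrow> 'x"
  Id :: "'x \<Rightarrow> 'f"
  Comp :: "'f \<Rightarrow> 'f \<Rightarrow> 'f" (infixl "\<odot>\<index>" 75)

record ('x, 'f, 'c) pre2cat = "('x, 'f) precat" +
  Cell :: "'c set"
  Src :: "'c \<Rightarrow> 'f"
  Tgt :: "'c \<Rightarrow> 'f"
  Id2 :: "'f \<Rightarrow> 'c"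
  VComp :: "'c \<Rightarrow> 'c \<Rightarrow> 'c" (infixl "\<cdot>\<index>" 70)
  HComp :: "'c \<Rightarrow> 'c \<Rightarrow> 'c" (infixl "\<star>\<index>" 75)

definition hom :: "('x, 'f, 'z) precat_scheme \<Rightarrow> 'x \<Rightarrow> 'x \<Rightarrow> 'f set" where
  "hom C x y = {f \<in> Mor C. Dom C f = x \<and> Cod C f = y}"

definition hom2 :: "('x, 'f, 'c, 'z) pre2cat_scheme \<Rightarrow> 'f \<Rightarrow> 'f \<Rightarrow> 'c set" where
  "hom2 C f g = {a \<in> Cell C. Src C a = f \<and> Tgt C a = g}"

locale category =
  fixes C :: "('x, 'f, 'z) precat_scheme" (structure)
  assumes Dom_Ob: "f \<in> Mor C \<Longrightarrow> Dom C f \<in> Ob C"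
    and Cod_Ob: "f \<in> Mor C \<Longrightarrow> Cod C f \<in> Ob C"
    and Id_hom: "x \<in> Ob C \<Longrightarrow> Id C x \<in> hom C x x"
    and Comp_hom: "g \<in> hom C y z \<Longrightarrow> f \<in> hom C x y \<Longrightarrow> g \<odot> f \<in> hom C x z"
    and Comp_Id: "f \<in> hom C x y \<Longrightarrow> f \<odot> Id C x = f"
    and Id_Comp: "f \<in> hom C x y \<Longrightarrow> Id C y \<odot> f = f"
    and Comp_assoc: "h \<in> hom C y z \<Longrightarrow> g \<in> hom C x y \<Longrightarrow> f \<in> hom C w x \<Longrightarrow>
      (h \<odot> g) \<odot> f = h \<odot> (g \<odot> f)"

text \<open>A \<open>Cat\<close>-enriched category: each \<open>hom C x y\<close> carries a category of 2-cells (the axioms on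
  \<open>\<cdot>\<close>), composition is a functor \<open>hom C y z \<times> hom C x y \<rightarrow> hom C x z\<close> (\<open>HComp_hom2\<close>,
  \<open>HComp_Id2\<close>, \<open>interchange\<close>), and it is strictly associative and unital, on 1-cells (from
  \<open>category\<close>) and on 2-cells.\<close>

locale two_category = category C
  for C :: "('x, 'f, 'c, 'z) pre2cat_scheme" (structure) +
  assumes Src_Mor: "a \<in> Cell C \<Longrightarrow> Src C a \<in> Mor C"
    and Tgt_Mor: "a \<in> Cell C \<Longrightarrow> Tgt C a \<in> Mor C"
    and Dom_Src_Tgt: "a \<in> Cell C \<Longrightarrow> Dom C (Src C a) = Dom C (Tgt C a)"
    and Cod_Src_Tgt: "a \<in> Cell C \<Longrightarrow> Cod C (Src C a) = Cod C (Tgt C a)"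
    and Id2_hom2: "f \<in> Mor C \<Longrightarrow> Id2 C f \<in> hom2 C f f"
    and VComp_hom2: "b \<in> hom2 C g h \<Longrightarrow> a \<in> hom2 C f g \<Longrightarrow> b \<cdot> a \<in> hom2 C f h"
    and VComp_Id2: "a \<in> hom2 C f g \<Longrightarrow> a \<cdot> Id2 C f = a"
    and Id2_VComp: "a \<in> hom2 C f g \<Longrightarrow> Id2 C g \<cdot> a = a"
    and VComp_assoc: "c \<in> hom2 C h k \<Longrightarrow> b \<in> hom2 C g h \<Longrightarrow> a \<in> hom2 C f g \<Longrightarrow>
      (c \<cdot> b) \<cdot> a = c \<cdot> (b \<cdot> a)"
    and HComp_hom2: "b \<in> hom2 C g g' \<Longrightarrow> a \<in> hom2 C f f' \<Longrightarrow> Dom C g = Cod C f \<Longrightarrow>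
      b \<star> a \<in> hom2 C (g \<odot> f) (g' \<odot> f')"
    and HComp_Id2: "g \<in> hom C y z \<Longrightarrow> f \<in> hom C x y \<Longrightarrow> Id2 C g \<star> Id2 C f = Id2 C (g \<odot> f)"
    and interchange: "b' \<in> hom2 C g' g'' \<Longrightarrow> b \<in> hom2 C g g' \<Longrightarrow>
      a' \<in> hom2 C f' f'' \<Longrightarrow> a \<in> hom2 C f f' \<Longrightarrow> Dom C g = Cod C f \<Longrightarrow>
      (b' \<cdot> b) \<star> (a' \<cdot> a) = (b' \<star> a') \<cdot> (b \<star> a)"
    and HComp_assoc: "c \<in> hom2 C h h' \<Longrightarrow> b \<in> hom2 C g g' \<Longrightarrow> a \<in> hom2 C f f' \<Longrightarrow>
      Dom C h = Cod C g \<Longrightarrow> Dom C g = Cod C f \<Longrightarrow> (c \<star> b) \<star> a = c \<star> (b \<star> a)"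
    and HComp_Id: "a \<in> hom2 C f f' \<Longrightarrow> a \<star> Id2 C (Id C (Dom C f)) = a"
    and Id_HComp: "a \<in> hom2 C f f' \<Longrightarrow> Id2 C (Id C (Cod C f)) \<star> a = a"

definition whiskerR :: "('x, 'f, 'c, 'z) pre2cat_scheme \<Rightarrow> 'c \<Rightarrow> 'f \<Rightarrow> 'c"
    (infixl "\<triangleleft>\<index>" 75) where
  "a \<triangleleft>\<^bsub>C\<^esub> f = a \<star>\<^bsub>C\<^esub> Id2 C f"

definition whiskerL :: "('x, 'f, 'c, 'z) pre2cat_scheme \<Rightarrow> 'f \<Rightarrow> 'c \<Rightarrow> 'c"
    (infixl "\<triangleright>\<index>" 75) where
  "g \<triangleright>\<^bsub>C\<^esub> a = Id2 C g \<star>\<^bsub>C\<^esub> a"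

definition inverse2 :: "('x, 'f, 'c, 'z) pre2cat_scheme \<Rightarrow> 'c \<Rightarrow> 'c \<Rightarrow> bool" where
  "inverse2 C a b \<longleftrightarrow> a \<in> Cell C \<and> b \<in> hom2 C (Tgt C a) (Src C a) \<and>
     b \<cdot>\<^bsub>C\<^esub> a = Id2 C (Src C a) \<and> a \<cdot>\<^bsub>C\<^esub> b = Id2 C (Tgt C a)"

definition invertible2 :: "('x, 'f, 'c, 'z) pre2cat_scheme \<Rightarrow> 'c \<Rightarrow> bool" where
  "invertible2 C a \<longleftrightarrow> (\<exists>b. inverse2 C a b)"

definition inv2 :: "('x, 'f, 'c, 'z) pre2cat_scheme \<Rightarrow> 'c \<Rightarrow> 'c" where
  "inv2 C a = (THE b. inverse2 C a b)"

definition equivalence :: "('x, 'f, 'c, 'z) pre2cat_scheme \<Rightarrow> 'f \<Rightarrow> bool" where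
  "equivalence C E \<longleftrightarrow> E \<in> Mor C \<and> (\<exists>E' \<in> hom C (Cod C E) (Dom C E).
     (\<exists>a \<in> hom2 C (E' \<odot>\<^bsub>C\<^esub> E) (Id C (Dom C E)). invertible2 C a) \<and>
     (\<exists>b \<in> hom2 C (E \<odot>\<^bsub>C\<^esub> E') (Id C (Cod C E)). invertible2 C b))"

text \<open>The codual 2-category: 2-cells are reversed, 1-cells are not.\<close>

definition co :: "('x, 'f, 'c, 'z) pre2cat_scheme \<Rightarrow> ('x, 'f, 'c, 'z) pre2cat_scheme" where
  "co C = C\<lparr>Src := Tgt C, Tgt := Src C, VComp := \<lambda>a b. b \<cdot>\<^bsub>C\<^esub> a\<rparr>"

lemma co_simps [simp]:
  "Ob (co C) = Ob C" "Mor (co C) = Mor C" "Dom (co C) = Dom C" "Cod (co C) = Cod C"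
  "Id (co C) = Id C" "f \<odot>\<^bsub>co C\<^esub> g = f \<odot>\<^bsub>C\<^esub> g" "Cell (co C) = Cell C"
  "Src (co C) = Tgt C" "Tgt (co C) = Src C" "Id2 (co C) = Id2 C"
  "a \<cdot>\<^bsub>co C\<^esub> b = b \<cdot>\<^bsub>C\<^esub> a" "a \<star>\<^bsub>co C\<^esub> b = a \<star>\<^bsub>C\<^esub> b"
  "a \<triangleleft>\<^bsub>co C\<^esub> f = a \<triangleleft>\<^bsub>C\<^esub> f" "f \<triangleright>\<^bsub>co C\<^esub> a = f \<triangleright>\<^bsub>C\<^esub> a"
  "hom (co C) x y = hom C x y" "hom2 (co C) f g = hom2 C g f"
  by (auto simp: co_def whiskerR_def whiskerL_def hom_def hom2_def)

lemma (in two_category) two_category_co: "two_category (co C)"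
proof -
  have d: "Dom C f = Dom C f'" "Cod C f = Cod C f'" if "a \<in> hom2 C f f'" for a f f'
    using that Dom_Src_Tgt Cod_Src_Tgt by (auto simp: hom2_def)
  show ?thesis
  proof (intro two_category.intro two_category_axioms.intro, goal_cases)
    case 1
    show ?case
      using Dom_Ob Cod_Ob Id_hom Comp_hom Comp_Id Id_Comp Comp_assoc by (intro category.intro) simp_all
  next
    case (11 b g g' a f f')
    then show ?case using d[of b] d[of a] HComp_hom2[of b g' g a f' f] by simp
  next
    case (13 b' g' g'' b g a' f' f'' a f)
    then show ?case using d[of b] d[of a] d[of b'] d[of a'] interchange[of b g' g b' g'' a f' f a' f'']
      by simp
  next
    case (14 c h h' b g g' a f f')
    then show ?case using d[of c] d[of b] d[of a] HComp_assoc[of c h' h b g' g a f' f] by simp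
  next
    case (15 a f f')
    then show ?case using d[of a] HComp_Id[of a f' f] by simp
  next
    case (16 a f f')
    then show ?case using d[of a] Id_HComp[of a f' f] by simp
  qed (simp_all add: Src_Mor Tgt_Mor Dom_Src_Tgt Cod_Src_Tgt Id2_hom2 VComp_hom2 VComp_Id2
      Id2_VComp VComp_assoc HComp_Id2)
qed

section \<open>The category \<open>\<Delta>\<^sub>3\<close>\<close>

text \<open>\<open>OMap m n [v\<^sub>0, \<dots>, v\<^sub>m\<^sub>-\<^sub>1]\<close> is the map from the ordinal \<open>{0..<m}\<close> to the ordinal
  \<open>{0..<n}\<close> that sends \<open>i\<close> to \<open>v\<^sub>i\<close>.\<close>

datatype omap = OMap (odom: nat) (ocod: nat) (ovals: "nat list")

definition oid :: "nat \<Rightarrow> omap" where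
  "oid n = OMap n n [0..<n]"

definition ocomp :: "omap \<Rightarrow> omap \<Rightarrow> omap" where
  "ocomp g f = OMap (odom f) (ocod g) (map (\<lambda>j. ovals g ! j) (ovals f))"

definition coface :: "nat \<Rightarrow> nat \<Rightarrow> omap" where
  "coface n i = OMap n (Suc n) (map (\<lambda>j. if j < i then j else Suc j) [0..<n])"

abbreviation cd :: "nat \<Rightarrow> omap" where "cd i \<equiv> coface 1 i"
abbreviation cD :: "nat \<Rightarrow> omap" where "cD i \<equiv> coface 2 i"

definition cs0 :: omap where "cs0 = OMap 2 1 [0, 0]"

inductive_set Delta3_arrows :: "omap set" where
  "n \<in> {1, 2, 3} \<Longrightarrow> oid n \<in> Delta3_arrows"
| "i \<in> {0, 1} \<Longrightarrow> cd i \<in> Delta3_arrows"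
| "cs0 \<in> Delta3_arrows"
| "i \<in> {0, 1, 2} \<Longrightarrow> cD i \<in> Delta3_arrows"
| "g \<in> Delta3_arrows \<Longrightarrow> f \<in> Delta3_arrows \<Longrightarrow> odom g = ocod f \<Longrightarrow> ocomp g f \<in> Delta3_arrows"

definition Delta3 :: "(nat, omap) precat" where
  "Delta3 = \<lparr>Ob = {1, 2, 3}, Mor = Delta3_arrows, Dom = odom, Cod = ocod, Id = oid, Comp = ocomp\<rparr>"

lemma Delta3_relations:
  "ocomp cs0 (cd 1) = oid 1" "ocomp cs0 (cd 0) = oid 1"
  "k < t \<Longrightarrow> t \<le> 2 \<Longrightarrow> ocomp (cD t) (cd k) = ocomp (cD k) (cd (t - 1))"
  by (auto simp: ocomp_def coface_def cs0_def oid_def numeral_2_eq_2)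

lemma Delta3_arrows_order_preserving:
  assumes "f \<in> Delta3_arrows"
  shows "odom f \<in> {1, 2, 3}" "ocod f \<in> {1, 2, 3}" "length (ovals f) = odom f"
    "\<forall>v \<in> set (ovals f). v < ocod f" "sorted (ovals f)"
proof -
  have "odom f \<in> {1, 2, 3} \<and> ocod f \<in> {1, 2, 3} \<and> length (ovals f) = odom f \<and>
    (\<forall>v \<in> set (ovals f). v < ocod f) \<and> sorted (ovals f)"
    using assms
  proof induction
    case (5 g f)
    then show ?case
      by (auto simp: ocomp_def sorted_iff_nth_mono)
  qed (auto simp: oid_def coface_def cs0_def numeral_2_eq_2)
  then show "odom f \<in> {1, 2, 3}" "ocod f \<in> {1, 2, 3}" "length (ovals f) = odom f"
    "\<forall>v \<in> set (ovals f). v < ocod f" "sorted (ovals f)"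
    by auto
qed

lemma category_Delta3: "category Delta3"
proof -
  note w = Delta3_arrows_order_preserving
  have ends: "odom (oid n) = n" "ocod (oid n) = n"
    "odom (ocomp g f) = odom f" "ocod (ocomp g f) = ocod g" for n g f
    by (simp_all add: oid_def ocomp_def)
  show ?thesis
  proof (unfold_locales, goal_cases)
    case (5 f x y)
    then show ?case using w(3)[of f]
      by (auto simp: Delta3_def hom_def ocomp_def oid_def map_nth intro!: omap.expand)
  next
    case (6 f x y)
    then show ?case using w(4)[of f]
      by (auto simp: Delta3_def hom_def ocomp_def oid_def intro!: omap.expand map_idI)
  next
    case (7 h y z g x f v)
    then show ?case using w(3)[of g] w(4)[of f]
      by (auto simp: Delta3_def hom_def ocomp_def)
  qed (use w(1,2) in \<open>auto simp: Delta3_def hom_def ends intro: Delta3_arrows.intros\<close>)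
qed

section \<open>Pseudofunctors from a category to a 2-category\<close>

text \<open>\<open>FComp P h g\<close> is the constraint \<open>P h \<odot> P g \<Rightarrow> P (h \<odot> g)\<close>, and \<open>FUnit P x\<close> is the
  constraint \<open>Id (P x) \<Rightarrow> P (Id x)\<close>.  The domain has only identity 2-cells, so there is no
  further action on 2-cells and no naturality to require.\<close>

record ('x, 'f, 'o, 'm, 'c) pseudofunctor_data =
  FOb :: "'x \<Rightarrow> 'o"
  FMor :: "'f \<Rightarrow> 'm"
  FComp :: "'f \<Rightarrow> 'f \<Rightarrow> 'c"
  FUnit :: "'x \<Rightarrow> 'c"

locale pseudofunctor = D: category D + two_category C
  for D :: "('x, 'f, 'y) precat_scheme" and C :: "('o, 'm, 'c, 'z) pre2cat_scheme" (structure) +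
  fixes P :: "('x, 'f, 'o, 'm, 'c) pseudofunctor_data"
  assumes FOb_Ob: "x \<in> Ob D \<Longrightarrow> FOb P x \<in> Ob C"
    and FMor_hom: "f \<in> hom D x y \<Longrightarrow> FMor P f \<in> hom C (FOb P x) (FOb P y)"
    and FComp_hom2: "h \<in> hom D y z \<Longrightarrow> g \<in> hom D x y \<Longrightarrow>
      FComp P h g \<in> hom2 C (FMor P h \<odot> FMor P g) (FMor P (h \<odot>\<^bsub>D\<^esub> g))"
    and FComp_invertible: "h \<in> hom D y z \<Longrightarrow> g \<in> hom D x y \<Longrightarrow> invertible2 C (FComp P h g)"
    and FUnit_hom2: "x \<in> Ob D \<Longrightarrow> FUnit P x \<in> hom2 C (Id C (FOb P x)) (FMor P (Id D x))"
    and FUnit_invertible: "x \<in> Ob D \<Longrightarrow> invertible2 C (FUnit P x)"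
    and F_assoc: "h \<in> hom D y z \<Longrightarrow> g \<in> hom D x y \<Longrightarrow> f \<in> hom D w x \<Longrightarrow>
      FComp P h (g \<odot>\<^bsub>D\<^esub> f) \<cdot> (FMor P h \<triangleright> FComp P g f) =
      FComp P (h \<odot>\<^bsub>D\<^esub> g) f \<cdot> (FComp P h g \<triangleleft> FMor P f)"
    and F_Id_right: "f \<in> hom D x y \<Longrightarrow>
      FComp P f (Id D x) \<cdot> (FMor P f \<triangleright> FUnit P x) = Id2 C (FMor P f)"
    and F_Id_left: "f \<in> hom D x y \<Longrightarrow>
      FComp P (Id D y) f \<cdot> (FUnit P y \<triangleleft> FMor P f) = Id2 C (FMor P f)"

section \<open>Descent data and lax descent objects\<close>

type_synonym ('o, 'm, 'c) Delta3_data = "(nat, omap, 'o, 'm, 'c) pseudofunctor_data"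

text \<open>The five cells below rely on the relations \<open>Delta3_relations\<close> for their typing.\<close>

definition sigma01 ::
  "('o, 'm, 'c, 'z) pre2cat_scheme \<Rightarrow> ('o, 'm, 'c) Delta3_data \<Rightarrow> 'c" where
  "sigma01 C A = inv2 C (FComp A (cD 0) (cd 0)) \<cdot>\<^bsub>C\<^esub> FComp A (cD 1) (cd 0)"

definition sigma02 ::
  "('o, 'm, 'c, 'z) pre2cat_scheme \<Rightarrow> ('o, 'm, 'c) Delta3_data \<Rightarrow> 'c" where
  "sigma02 C A = inv2 C (FComp A (cD 0) (cd 1)) \<cdot>\<^bsub>C\<^esub> FComp A (cD 2) (cd 0)"

definition sigma12 ::
  "('o, 'm, 'c, 'z) pre2cat_scheme \<Rightarrow> ('o, 'm, 'c) Delta3_data \<Rightarrow> 'c" where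
  "sigma12 C A = inv2 C (FComp A (cD 1) (cd 1)) \<cdot>\<^bsub>C\<^esub> FComp A (cD 2) (cd 1)"

definition nu0 ::
  "('o, 'm, 'c, 'z) pre2cat_scheme \<Rightarrow> ('o, 'm, 'c) Delta3_data \<Rightarrow> 'c" where
  "nu0 C A = inv2 C (FUnit A 1) \<cdot>\<^bsub>C\<^esub> FComp A cs0 (cd 0)"

definition nu1 ::
  "('o, 'm, 'c, 'z) pre2cat_scheme \<Rightarrow> ('o, 'm, 'c) Delta3_data \<Rightarrow> 'c" where
  "nu1 C A = inv2 C (FUnit A 1) \<cdot>\<^bsub>C\<^esub> FComp A cs0 (cd 1)"

definition descent_datum ::
  "('o, 'm, 'c, 'z) pre2cat_scheme \<Rightarrow> ('o, 'm, 'c) Delta3_data \<Rightarrow> 'm \<Rightarrow> 'c \<Rightarrow> bool" where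
  "descent_datum C A F \<beta> \<longleftrightarrow>
     F \<in> Mor C \<and> Cod C F = FOb A 1 \<and>
     \<beta> \<in> hom2 C (FMor A (cd 1) \<odot>\<^bsub>C\<^esub> F) (FMor A (cd 0) \<odot>\<^bsub>C\<^esub> F) \<and>
     (sigma01 C A \<triangleleft>\<^bsub>C\<^esub> F) \<cdot>\<^bsub>C\<^esub> (FMor A (cD 1) \<triangleright>\<^bsub>C\<^esub> \<beta>) \<cdot>\<^bsub>C\<^esub> (sigma12 C A \<triangleleft>\<^bsub>C\<^esub> F) =
     (FMor A (cD 0) \<triangleright>\<^bsub>C\<^esub> \<beta>) \<cdot>\<^bsub>C\<^esub> (sigma02 C A \<triangleleft>\<^bsub>C\<^esub> F) \<cdot>\<^bsub>C\<^esub> (FMor A (cD 2) \<triangleright>\<^bsub>C\<^esub> \<beta>) \<and>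
     (nu0 C A \<triangleleft>\<^bsub>C\<^esub> F) \<cdot>\<^bsub>C\<^esub> (FMor A cs0 \<triangleright>\<^bsub>C\<^esub> \<beta>) \<cdot>\<^bsub>C\<^esub> (inv2 C (nu1 C A) \<triangleleft>\<^bsub>C\<^esub> F) = Id2 C F"

definition lax_descent_object ::
  "('o, 'm, 'c, 'z) pre2cat_scheme \<Rightarrow> ('o, 'm, 'c) Delta3_data \<Rightarrow> 'o \<Rightarrow> 'm \<Rightarrow> 'c \<Rightarrow> bool" where
  "lax_descent_object C A L d \<psi> \<longleftrightarrow>
     L \<in> Ob C \<and> d \<in> hom C L (FOb A 1) \<and> descent_datum C A d \<psi> \<and>
     (\<forall>S \<in> Ob C. \<forall>F \<in> hom C S (FOb A 1). \<forall>\<beta>. descent_datum C A F \<beta> \<longrightarrow>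
        (\<exists>!F'. F' \<in> hom C S L \<and> d \<odot>\<^bsub>C\<^esub> F' = F \<and> \<psi> \<triangleleft>\<^bsub>C\<^esub> F' = \<beta>)) \<and>
     (\<forall>S \<in> Ob C. \<forall>F1 \<in> hom C S L. \<forall>F0 \<in> hom C S L.
        \<forall>\<xi> \<in> hom2 C (d \<odot>\<^bsub>C\<^esub> F1) (d \<odot>\<^bsub>C\<^esub> F0).
        (\<psi> \<triangleleft>\<^bsub>C\<^esub> F0) \<cdot>\<^bsub>C\<^esub> (FMor A (cd 1) \<triangleright>\<^bsub>C\<^esub> \<xi>) =
        (FMor A (cd 0) \<triangleright>\<^bsub>C\<^esub> \<xi>) \<cdot>\<^bsub>C\<^esub> (\<psi> \<triangleleft>\<^bsub>C\<^esub> F1) \<longrightarrow>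
        (\<exists>!\<xi>'. \<xi>' \<in> hom2 C F1 F0 \<and> d \<triangleright>\<^bsub>C\<^esub> \<xi>' = \<xi>))"

section \<open>Kan extensions\<close>

text \<open>\<open>is_ran C H J K \<gamma>\<close>: the pair \<open>(K, \<gamma>)\<close> is the right Kan extension of \<open>J\<close> along \<open>H\<close>.\<close>

definition is_ran ::
  "('x, 'f, 'c, 'z) pre2cat_scheme \<Rightarrow> 'f \<Rightarrow> 'f \<Rightarrow> 'f \<Rightarrow> 'c \<Rightarrow> bool" where
  "is_ran C H J K \<gamma> \<longleftrightarrow>
     H \<in> Mor C \<and> J \<in> Mor C \<and> Dom C H = Dom C J \<and>
     K \<in> hom C (Cod C H) (Cod C J) \<and> \<gamma> \<in> hom2 C (K \<odot>\<^bsub>C\<^esub> H) J \<and>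
     (\<forall>R \<in> hom C (Cod C H) (Cod C J).
        bij_betw (\<lambda>\<beta>. \<gamma> \<cdot>\<^bsub>C\<^esub> (\<beta> \<triangleleft>\<^bsub>C\<^esub> H)) (hom2 C R K) (hom2 C (R \<odot>\<^bsub>C\<^esub> H) J))"

definition preserves_ran ::
  "('x, 'f, 'c, 'z) pre2cat_scheme \<Rightarrow> 'f \<Rightarrow> 'f \<Rightarrow> 'f \<Rightarrow> 'f \<Rightarrow> 'c \<Rightarrow> bool" where
  "preserves_ran C G H J K \<gamma> \<longleftrightarrow> is_ran C H (G \<odot>\<^bsub>C\<^esub> J) (G \<odot>\<^bsub>C\<^esub> K) (G \<triangleright>\<^bsub>C\<^esub> \<gamma>)"

definition reflects_ran ::
  "('x, 'f, 'c, 'z) pre2cat_scheme \<Rightarrow> 'f \<Rightarrow> 'f \<Rightarrow> 'f \<Rightarrow> bool" where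
  "reflects_ran C G H J \<longleftrightarrow>
     (\<forall>K \<in> hom C (Cod C H) (Cod C J). \<forall>\<gamma> \<in> hom2 C (K \<odot>\<^bsub>C\<^esub> H) J.
        is_ran C H (G \<odot>\<^bsub>C\<^esub> J) (G \<odot>\<^bsub>C\<^esub> K) (G \<triangleright>\<^bsub>C\<^esub> \<gamma>) \<longrightarrow> is_ran C H J K \<gamma>)"

text \<open>\<open>G\<close> creates the right Kan extension of \<open>G \<odot> J\<close> along \<open>H\<close>; this is only meaningful when
  that Kan extension exists.\<close>

definition creates_ran ::
  "('x, 'f, 'c, 'z) pre2cat_scheme \<Rightarrow> 'f \<Rightarrow> 'f \<Rightarrow> 'f \<Rightarrow> bool" where
  "creates_ran C G H J \<longleftrightarrow> reflects_ran C G H J \<and>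
     (\<exists>K \<gamma>. is_ran C H J K \<gamma>) \<and>
     (\<forall>K \<gamma>. is_ran C H J K \<gamma> \<longrightarrow> preserves_ran C G H J K \<gamma>)"

definition is_absolute_ran ::
  "('x, 'f, 'c, 'z) pre2cat_scheme \<Rightarrow> 'f \<Rightarrow> 'f \<Rightarrow> 'f \<Rightarrow> 'c \<Rightarrow> bool" where
  "is_absolute_ran C H J K \<gamma> \<longleftrightarrow> is_ran C H J K \<gamma> \<and>
     (\<forall>G \<in> Mor C. Dom C G = Cod C K \<longrightarrow> preserves_ran C G H J K \<gamma>)"

definition creates_absolute_ran ::
  "('x, 'f, 'c, 'z) pre2cat_scheme \<Rightarrow> 'f \<Rightarrow> bool" where
  "creates_absolute_ran C G \<longleftrightarrow>
     (\<forall>H \<in> Mor C. \<forall>J \<in> Mor C. Dom C H = Dom C J \<longrightarrow> Cod C J = Dom C G \<longrightarrow>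
        (\<exists>K \<gamma>. is_absolute_ran C H (G \<odot>\<^bsub>C\<^esub> J) K \<gamma>) \<longrightarrow> creates_ran C G H J)"

text \<open>The notions for left Kan extensions are those for right Kan extensions in the codual
  2-category.\<close>

definition creates_absolute_lan ::
  "('x, 'f, 'c, 'z) pre2cat_scheme \<Rightarrow> 'f \<Rightarrow> bool" where
  "creates_absolute_lan C G \<longleftrightarrow> creates_absolute_ran (co C) G"

lemma is_ran_co:
  "is_ran (co C) H J K \<gamma> \<longleftrightarrow>
     H \<in> Mor C \<and> J \<in> Mor C \<and> Dom C H = Dom C J \<and>
     K \<in> hom C (Cod C H) (Cod C J) \<and> \<gamma> \<in> hom2 C J (K \<odot>\<^bsub>C\<^esub> H) \<and>
     (\<forall>R \<in> hom C (Cod C H) (Cod C J).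
        bij_betw (\<lambda>\<beta>. (\<beta> \<triangleleft>\<^bsub>C\<^esub> H) \<cdot>\<^bsub>C\<^esub> \<gamma>) (hom2 C K R) (hom2 C J (R \<odot>\<^bsub>C\<^esub> H)))"
  by (simp add: is_ran_def)

definition creates_absolute_kan ::
  "('x, 'f, 'c, 'z) pre2cat_scheme \<Rightarrow> 'f \<Rightarrow> bool" where
  "creates_absolute_kan C G \<longleftrightarrow> creates_absolute_ran C G \<and> creates_absolute_lan C G"

end

theory Submission
  imports Defs
begin

text \<open>Let \<open>d : L \<rightarrow> X\<close> be the forgetful morphism, with its universal datum
  \<open>\<psi> : p1 d \<Rightarrow> p0 d\<close>, and let \<open>(K, \<gamma>)\<close> be an absolute right Kan extension of \<open>d J\<close> along \<open>H\<close>.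
  As \<open>p0\<close> preserves it, there is a unique \<open>\<phi> : p1 K \<Rightarrow> p0 K\<close> that \<open>\<gamma>\<close> carries to \<open>\<psi> J\<close>, that
  is, \<open>p0 \<gamma> \<cdot> \<phi> H = \<psi> J \<cdot> p1 \<gamma>\<close>.  This \<open>\<phi>\<close> is a descent datum for \<open>K\<close>: the two sides of the
  cocycle equation agree after \<open>\<gamma>\<close> has been pasted on, because there they become, by naturality,
  the two sides of the cocycle equation of \<open>\<psi>\<close>; and 2-cells into \<open>q0 p0 K\<close> are detected in this
  way because \<open>q0 p0\<close> also preserves \<open>(K, \<gamma>)\<close>.  The unit equation is similar, with values in \<open>K\<close>
  itself.  So \<open>K\<close> lifts to \<open>L\<close>, and the equation that defines \<open>\<phi>\<close> says exactly that \<open>\<gamma>\<close> lifts too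
  (\<open>forgetful_lifts_ran_cell\<close>).

  A pair in \<open>L\<close> whose image under \<open>d\<close> is a Kan extension preserved by \<open>p0\<close> is itself a Kan
  extension: a factorization found downstairs is compatible with \<open>\<psi>\<close>, since both composites into
  \<open>p0 d K\<close> agree after pasting with \<open>p0 d \<gamma>\<close> (\<open>forgetful_lifts_ran\<close>).  This gives existence from the
  lift just built, and also reflection; preservation then follows from uniqueness of Kan extensions.

  Left Kan extensions are right Kan extensions for the reversed 2-cells.  Reversing the
  2-cells swaps the roles of \<open>p0\<close> and \<open>p1\<close> and of \<open>q0\<close> and \<open>q2\<close>, and the resulting
  equations on a descent datum are the same (\<open>lax_descent_co\<close>), so the argument applies to
  them unchanged.

  An equivalence preserves and reflects all Kan extensions, and an absolute Kan extension of \<open>E J\<close>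
  gives one of \<open>J\<close> by composing with a pseudo-inverse of \<open>E\<close>.  Creation of absolute Kan extensions
  is therefore stable under composition with equivalences on either side.\<close>

section \<open>Calculating in a 2-category\<close>

text \<open>The axioms are restated with composability expressed by equations between \<open>Dom\<close>, \<open>Cod\<close>,
  \<open>Src\<close> and \<open>Tgt\<close>, so that the simplifier can type-check the composites that it rewrites.  The normal
  form has composites of 1-cells and vertical composites bracketed to the right, whiskering
  distributed over both, and whiskering on the left outside whiskering on the right.\<close>

lemma hom_iff: "f \<in> hom C x y \<longleftrightarrow> f \<in> Mor C \<and> Dom C f = x \<and> Cod C f = y"
  by (simp add: hom_def)

lemma hom2_iff: "a \<in> hom2 C f g \<longleftrightarrow> a \<in> Cell C \<and> Src C a = f \<and> Tgt C a = g"
  by (simp add: hom2_def)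

context two_category
begin

lemma Ob_simps [simp]:
  "f \<in> Mor C \<Longrightarrow> Dom C f \<in> Ob C" "f \<in> Mor C \<Longrightarrow> Cod C f \<in> Ob C"
  by (simp_all add: Dom_Ob Cod_Ob)

lemma Id_simps [simp]:
  assumes "x \<in> Ob C"
  shows "Id C x \<in> Mor C" "Dom C (Id C x) = x" "Cod C (Id C x) = x"
  using Id_hom[OF assms] by (simp_all add: hom_iff)

lemma Comp_simps [simp]:
  assumes "g \<in> Mor C" "f \<in> Mor C" "Dom C g = Cod C f"
  shows "g \<odot> f \<in> Mor C" "Dom C (g \<odot> f) = Dom C f" "Cod C (g \<odot> f) = Cod C g"
  using Comp_hom[of g "Dom C g" "Cod C g" f "Dom C f"] assms by (simp_all add: hom_iff)

lemma Comp_unit [simp]: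
  "f \<in> Mor C \<Longrightarrow> Dom C f = x \<Longrightarrow> f \<odot> Id C x = f" "f \<in> Mor C \<Longrightarrow> Cod C f = x \<Longrightarrow> Id C x \<odot> f = f"
  using Comp_Id[of f] Id_Comp[of f] by (auto simp: hom_iff)

lemma Comp_assoc' [simp]:
  "h \<in> Mor C \<Longrightarrow> g \<in> Mor C \<Longrightarrow> f \<in> Mor C \<Longrightarrow> Dom C h = Cod C g \<Longrightarrow> Dom C g = Cod C f \<Longrightarrow>
    (h \<odot> g) \<odot> f = h \<odot> (g \<odot> f)"
  using Comp_assoc[of h "Dom C h" "Cod C h" g "Dom C g" f "Dom C f"] by (auto simp: hom_iff)

lemma Cell_simps [simp]:
  assumes "a \<in> Cell C"
  shows "Src C a \<in> Mor C" "Tgt C a \<in> Mor C"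
    "Dom C (Tgt C a) = Dom C (Src C a)" "Cod C (Tgt C a) = Cod C (Src C a)"
  using Src_Mor[OF assms] Tgt_Mor[OF assms] Dom_Src_Tgt[OF assms] Cod_Src_Tgt[OF assms] by auto

lemma Id2_simps [simp]:
  assumes "f \<in> Mor C"
  shows "Id2 C f \<in> Cell C" "Src C (Id2 C f) = f" "Tgt C (Id2 C f) = f"
  using Id2_hom2[OF assms] by (simp_all add: hom2_iff)

lemma VComp_simps [simp]:
  assumes "b \<in> Cell C" "a \<in> Cell C" "Src C b = Tgt C a"
  shows "b \<cdot> a \<in> Cell C" "Src C (b \<cdot> a) = Src C a" "Tgt C (b \<cdot> a) = Tgt C b"
  using VComp_hom2[of b "Src C b" "Tgt C b" a "Src C a"] assms by (simp_all add: hom2_iff)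

lemma VComp_unit [simp]:
  "a \<in> Cell C \<Longrightarrow> Src C a = f \<Longrightarrow> a \<cdot> Id2 C f = a" "a \<in> Cell C \<Longrightarrow> Tgt C a = f \<Longrightarrow> Id2 C f \<cdot> a = a"
  using VComp_Id2[of a] Id2_VComp[of a] by (auto simp: hom2_iff)

lemma VComp_assoc' [simp]:
  "c \<in> Cell C \<Longrightarrow> b \<in> Cell C \<Longrightarrow> a \<in> Cell C \<Longrightarrow> Src C c = Tgt C b \<Longrightarrow> Src C b = Tgt C a \<Longrightarrow>
    (c \<cdot> b) \<cdot> a = c \<cdot> (b \<cdot> a)"
  using VComp_assoc[of c "Src C c" "Tgt C c" b "Src C b" a "Src C a"] by (auto simp: hom2_iff)

lemma whiskerL_simps [simp]:
  assumes "g \<in> Mor C" "a \<in> Cell C" "Dom C g = Cod C (Src C a)"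
  shows "g \<triangleright> a \<in> Cell C" "Src C (g \<triangleright> a) = g \<odot> Src C a" "Tgt C (g \<triangleright> a) = g \<odot> Tgt C a"
  using HComp_hom2[of "Id2 C g" g g a "Src C a" "Tgt C a"] assms
  by (simp_all add: hom2_iff whiskerL_def)

lemma whiskerR_simps [simp]:
  assumes "f \<in> Mor C" "a \<in> Cell C" "Dom C (Src C a) = Cod C f"
  shows "a \<triangleleft> f \<in> Cell C" "Src C (a \<triangleleft> f) = Src C a \<odot> f" "Tgt C (a \<triangleleft> f) = Tgt C a \<odot> f"
  using HComp_hom2[of a "Src C a" "Tgt C a" "Id2 C f" f f] assms
  by (simp_all add: hom2_iff whiskerR_def)

lemma whiskerL_Id2 [simp]:
  "g \<in> Mor C \<Longrightarrow> f \<in> Mor C \<Longrightarrow> Dom C g = Cod C f \<Longrightarrow> g \<triangleright> Id2 C f = Id2 C (g \<odot> f)"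
  using HComp_Id2[of g "Dom C g" "Cod C g" f "Dom C f"] by (simp add: whiskerL_def hom_iff)

lemma whiskerR_Id2 [simp]:
  "g \<in> Mor C \<Longrightarrow> f \<in> Mor C \<Longrightarrow> Dom C g = Cod C f \<Longrightarrow> Id2 C g \<triangleleft> f = Id2 C (g \<odot> f)"
  using HComp_Id2[of g "Dom C g" "Cod C g" f "Dom C f"] by (simp add: whiskerR_def hom_iff)

lemma whisker_Id [simp]:
  "a \<in> Cell C \<Longrightarrow> Cod C (Src C a) = x \<Longrightarrow> Id C x \<triangleright> a = a"
  "a \<in> Cell C \<Longrightarrow> Dom C (Src C a) = x \<Longrightarrow> a \<triangleleft> Id C x = a"
  using Id_HComp[of a "Src C a" "Tgt C a"] HComp_Id[of a "Src C a" "Tgt C a"]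
  by (auto simp: whiskerL_def whiskerR_def hom2_iff)

lemma whiskerL_VComp [simp]:
  "g \<in> Mor C \<Longrightarrow> b \<in> Cell C \<Longrightarrow> a \<in> Cell C \<Longrightarrow> Src C b = Tgt C a \<Longrightarrow> Dom C g = Cod C (Src C a) \<Longrightarrow>
    g \<triangleright> (b \<cdot> a) = (g \<triangleright> b) \<cdot> (g \<triangleright> a)"
  using interchange[of "Id2 C g" g g "Id2 C g" g b "Tgt C a" "Tgt C b" a "Src C a"]
  by (simp add: whiskerL_def hom2_iff)

lemma whiskerR_VComp [simp]:
  "f \<in> Mor C \<Longrightarrow> b \<in> Cell C \<Longrightarrow> a \<in> Cell C \<Longrightarrow> Src C b = Tgt C a \<Longrightarrow> Dom C (Src C a) = Cod C f \<Longrightarrow>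
    (b \<cdot> a) \<triangleleft> f = (b \<triangleleft> f) \<cdot> (a \<triangleleft> f)"
  using interchange[of b "Tgt C a" "Tgt C b" a "Src C a" "Id2 C f" f f "Id2 C f" f]
  by (simp add: whiskerR_def hom2_iff)

lemma whiskerL_Comp [simp]:
  "g \<in> Mor C \<Longrightarrow> h \<in> Mor C \<Longrightarrow> a \<in> Cell C \<Longrightarrow> Dom C g = Cod C h \<Longrightarrow> Dom C h = Cod C (Src C a) \<Longrightarrow>
    (g \<odot> h) \<triangleright> a = g \<triangleright> (h \<triangleright> a)"
  using HComp_assoc[of "Id2 C g" g g "Id2 C h" h h a "Src C a" "Tgt C a"]
    HComp_Id2[of g "Dom C g" "Cod C g" h "Dom C h"]
  by (simp add: whiskerL_def hom2_iff hom_iff)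

lemma whiskerR_Comp [simp]:
  "f \<in> Mor C \<Longrightarrow> h \<in> Mor C \<Longrightarrow> a \<in> Cell C \<Longrightarrow> Dom C f = Cod C h \<Longrightarrow> Dom C (Src C a) = Cod C f \<Longrightarrow>
    a \<triangleleft> (f \<odot> h) = (a \<triangleleft> f) \<triangleleft> h"
  using HComp_assoc[of a "Src C a" "Tgt C a" "Id2 C f" f f "Id2 C h" h h]
    HComp_Id2[of f "Dom C f" "Cod C f" h "Dom C h"]
  by (simp add: whiskerR_def hom2_iff hom_iff)

lemma whiskerL_whiskerR [simp]:
  "g \<in> Mor C \<Longrightarrow> f \<in> Mor C \<Longrightarrow> a \<in> Cell C \<Longrightarrow> Dom C g = Cod C (Src C a) \<Longrightarrow>
    Dom C (Src C a) = Cod C f \<Longrightarrow> (g \<triangleright> a) \<triangleleft> f = g \<triangleright> (a \<triangleleft> f)"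
  using HComp_assoc[of "Id2 C g" g g a "Src C a" "Tgt C a" "Id2 C f" f f]
  by (simp add: whiskerL_def whiskerR_def hom2_iff)

text \<open>Both sides are the horizontal composite \<open>b \<star> a\<close>.  This is the naturality used in every
  pasting argument below.\<close>

lemma whisker_natural:
  assumes "b \<in> Cell C" "a \<in> Cell C" "Dom C (Src C b) = Cod C (Src C a)"
  shows "(Tgt C b \<triangleright> a) \<cdot> (b \<triangleleft> Src C a) = (b \<triangleleft> Tgt C a) \<cdot> (Src C b \<triangleright> a)"
proof -
  have "(Tgt C b \<triangleright> a) \<cdot> (b \<triangleleft> Src C a) = b \<star> a"
    using interchange[of "Id2 C (Tgt C b)" "Tgt C b" "Tgt C b" b "Src C b" a "Src C a" "Tgt C a"
        "Id2 C (Src C a)" "Src C a"] assms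
    by (simp add: whiskerL_def whiskerR_def hom2_iff)
  moreover have "(b \<triangleleft> Tgt C a) \<cdot> (Src C b \<triangleright> a) = b \<star> a"
    using interchange[of b "Src C b" "Tgt C b" "Id2 C (Src C b)" "Src C b"
        "Id2 C (Tgt C a)" "Tgt C a" "Tgt C a" a "Src C a"] assms
    by (simp add: whiskerL_def whiskerR_def hom2_iff)
  ultimately show ?thesis by simp
qed

text \<open>Lets an equation between binary composites act inside a right-bracketed chain.\<close>

lemma VComp_eq_extend:
  assumes "b \<cdot> a = b' \<cdot> a'" "a \<in> Cell C" "b \<in> Cell C" "a' \<in> Cell C" "b' \<in> Cell C" "c \<in> Cell C"
    "Src C b = Tgt C a" "Src C b' = Tgt C a'" "Src C a = Tgt C c" "Src C a' = Tgt C c"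
  shows "b \<cdot> (a \<cdot> c) = b' \<cdot> (a' \<cdot> c)"
  using VComp_assoc'[of b a c] VComp_assoc'[of b' a' c] assms by simp

subsection \<open>Invertible 2-cells\<close>

lemma inverse2_iff:
  "inverse2 C a b \<longleftrightarrow> a \<in> Cell C \<and> b \<in> Cell C \<and> Src C b = Tgt C a \<and> Tgt C b = Src C a \<and>
    b \<cdot> a = Id2 C (Src C a) \<and> a \<cdot> b = Id2 C (Tgt C a)"
  by (auto simp: inverse2_def hom2_iff)

lemma inverse2_inv2:
  assumes "invertible2 C a"
  shows "inverse2 C a (inv2 C a)"
  unfolding inv2_def
proof (rule theI')
  obtain b where b: "inverse2 C a b"
    using assms by (auto simp: invertible2_def)
  have "c = b" if "inverse2 C a c" for c
    using b that VComp_assoc'[of b a c] by (simp add: inverse2_iff)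
  with b show "\<exists>!b. inverse2 C a b" by blast
qed

lemma inverse2_whiskerL:
  "inverse2 C a b \<Longrightarrow> g \<in> Mor C \<Longrightarrow> Dom C g = Cod C (Src C a) \<Longrightarrow> inverse2 C (g \<triangleright> a) (g \<triangleright> b)"
  using whiskerL_VComp[of g a b] whiskerL_VComp[of g b a]
  by (simp add: inverse2_iff del: whiskerL_VComp)

lemma inverse2_whiskerR:
  "inverse2 C a b \<Longrightarrow> f \<in> Mor C \<Longrightarrow> Dom C (Src C a) = Cod C f \<Longrightarrow> inverse2 C (a \<triangleleft> f) (b \<triangleleft> f)"
  using whiskerR_VComp[of f a b] whiskerR_VComp[of f b a]
  by (simp add: inverse2_iff del: whiskerR_VComp)

lemma inverse2_cancel:
  assumes "inverse2 C a b" "x \<in> Cell C"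
  shows "Tgt C x = Src C a \<Longrightarrow> b \<cdot> (a \<cdot> x) = x" "Tgt C x = Tgt C a \<Longrightarrow> a \<cdot> (b \<cdot> x) = x"
  using assms VComp_assoc'[of b a x] VComp_assoc'[of a b x] by (simp_all add: inverse2_iff)

lemma bij_VComp_left:
  assumes "inverse2 C j i" "Src C j = g" "Tgt C j = g'"
  shows "bij_betw (\<lambda>x. j \<cdot> x) (hom2 C f g) (hom2 C f g')"
  by (rule bij_betw_byWitness[where f' = "\<lambda>x. i \<cdot> x"])
    (use assms in \<open>auto simp: hom2_iff inverse2_cancel inverse2_iff\<close>)

lemma bij_VComp_right:
  assumes "inverse2 C j i" "Src C j = f" "Tgt C j = f'"
  shows "bij_betw (\<lambda>x. x \<cdot> j) (hom2 C f' g) (hom2 C f g)"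
  by (rule bij_betw_byWitness[where f' = "\<lambda>x. x \<cdot> i"])
    (use assms in \<open>auto simp: hom2_iff inverse2_iff\<close>)

section \<open>Kan extensions\<close>

lemma hom2D:
  assumes "a \<in> hom2 C f g"
  shows "a \<in> Cell C" "Src C a = f" "Tgt C a = g" "f \<in> Mor C" "g \<in> Mor C"
    "Dom C g = Dom C f" "Cod C g = Cod C f"
  using assms Src_Mor[of a] Tgt_Mor[of a] Dom_Src_Tgt[of a] Cod_Src_Tgt[of a]
  unfolding hom2_iff by metis+

lemma is_ranD:
  assumes "is_ran C H J K \<gamma>"
  shows "H \<in> Mor C" "J \<in> Mor C" "Dom C H = Dom C J" "K \<in> Mor C" "Dom C K = Cod C H"
    "Cod C K = Cod C J" "\<gamma> \<in> Cell C" "Src C \<gamma> = K \<odot> H" "Tgt C \<gamma> = J"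
  using assms by (simp_all add: is_ran_def hom_iff hom2_iff)

lemma is_ran_bij:
  assumes "is_ran C H J K \<gamma>" "R \<in> Mor C" "Dom C R = Cod C H" "Cod C R = Cod C J"
  shows "bij_betw (\<lambda>\<beta>. \<gamma> \<cdot> (\<beta> \<triangleleft> H)) (hom2 C R K) (hom2 C (R \<odot> H) J)"
  using assms by (simp add: is_ran_def hom_iff)

lemma is_ranI:
  assumes "H \<in> Mor C" "J \<in> Mor C" "Dom C H = Dom C J" "K \<in> Mor C" "Dom C K = Cod C H"
    "Cod C K = Cod C J" "\<gamma> \<in> Cell C" "Src C \<gamma> = K \<odot> H" "Tgt C \<gamma> = J"
    and "\<And>R. R \<in> Mor C \<Longrightarrow> Dom C R = Cod C H \<Longrightarrow> Cod C R = Cod C J \<Longrightarrow>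
      bij_betw (\<lambda>\<beta>. \<gamma> \<cdot> (\<beta> \<triangleleft> H)) (hom2 C R K) (hom2 C (R \<odot> H) J)"
  shows "is_ran C H J K \<gamma>"
  using assms by (simp add: is_ran_def hom_iff hom2_iff)

lemma is_ran_factor:
  assumes "is_ran C H J K \<gamma>" "R \<in> Mor C" "Dom C R = Cod C H" "Cod C R = Cod C J"
    and "\<alpha> \<in> Cell C" "Src C \<alpha> = R \<odot> H" "Tgt C \<alpha> = J"
  obtains \<beta> where "\<beta> \<in> Cell C" "Src C \<beta> = R" "Tgt C \<beta> = K" "\<gamma> \<cdot> (\<beta> \<triangleleft> H) = \<alpha>"
proof -
  have "\<alpha> \<in> (\<lambda>\<beta>. \<gamma> \<cdot> (\<beta> \<triangleleft> H)) ` hom2 C R K"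
    using is_ran_bij[OF assms(1-4)] assms(5-7) by (simp add: bij_betw_def hom2_iff)
  then show ?thesis by (auto simp: hom2_iff intro: that)
qed

lemma is_ran_eq:
  assumes r: "is_ran C H J K \<gamma>"
    and \<beta>: "\<beta> \<in> Cell C" "Src C \<beta> = R" "Tgt C \<beta> = K" "\<beta>' \<in> Cell C" "Src C \<beta>' = R" "Tgt C \<beta>' = K"
    and eq: "\<gamma> \<cdot> (\<beta> \<triangleleft> H) = \<gamma> \<cdot> (\<beta>' \<triangleleft> H)"
  shows "\<beta> = \<beta>'"
proof -
  have \<beta>_hom: "\<beta> \<in> hom2 C R K" "\<beta>' \<in> hom2 C R K"
    using \<beta> by (simp_all add: hom2_iff)
  have "inj_on (\<lambda>\<beta>. \<gamma> \<cdot> (\<beta> \<triangleleft> H)) (hom2 C R K)"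
    using is_ran_bij[OF r, of R] hom2D[OF \<beta>_hom(1)] is_ranD[OF r] by (simp add: bij_betw_def)
  then show ?thesis
    using eq \<beta>_hom by (rule inj_onD)
qed

text \<open>The defining map is the old one between two bijections, composition with \<open>k\<close> and with
  \<open>j\<close>.\<close>

lemma is_ran_transport:
  assumes r: "is_ran C H J K \<gamma>"
    and k: "invertible2 C k" "k \<in> hom2 C K' K" and j: "invertible2 C j" "j \<in> hom2 C J J'"
  shows "is_ran C H J' K' (j \<cdot> (\<gamma> \<cdot> (k \<triangleleft> H)))"
proof -
  obtain k' j' where k': "inverse2 C k k'" and j': "inverse2 C j j'"
    using k j by (auto simp: invertible2_def)
  note [simp] = is_ranD[OF r] hom2D[OF j(2)] hom2D(1-4)[OF k(2)]
  have [simp]: "Dom C K' = Cod C H" "Cod C K' = Cod C J"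
    using hom2D[OF k(2)] is_ranD[OF r] by simp_all
  show ?thesis
  proof (rule is_ranI)
    fix R assume "R \<in> Mor C" "Dom C R = Cod C H" "Cod C R = Cod C J'"
    then have R [simp]: "R \<in> Mor C" "Dom C R = Cod C H" "Cod C R = Cod C J" by simp_all
    have "bij_betw ((\<lambda>x. j \<cdot> x) \<circ> ((\<lambda>\<beta>. \<gamma> \<cdot> (\<beta> \<triangleleft> H)) \<circ> (\<lambda>x. k \<cdot> x)))
        (hom2 C R K') (hom2 C (R \<odot> H) J')"
      by (rule bij_betw_trans[OF bij_betw_trans[OF bij_VComp_left[OF k'] is_ran_bij[OF r R]]
            bij_VComp_left[OF j']]) simp_all
    moreover have "((\<lambda>x. j \<cdot> x) \<circ> ((\<lambda>\<beta>. \<gamma> \<cdot> (\<beta> \<triangleleft> H)) \<circ> (\<lambda>x. k \<cdot> x))) \<beta> =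
        (j \<cdot> (\<gamma> \<cdot> (k \<triangleleft> H))) \<cdot> (\<beta> \<triangleleft> H)" if "\<beta> \<in> hom2 C R K'" for \<beta>
      using hom2D(1-3)[OF that] by simp
    ultimately show "bij_betw (\<lambda>\<beta>. (j \<cdot> (\<gamma> \<cdot> (k \<triangleleft> H))) \<cdot> (\<beta> \<triangleleft> H)) (hom2 C R K') (hom2 C (R \<odot> H) J')"
      by (rule bij_betw_cong[THEN iffD1, rotated])
  qed simp_all
qed

lemma is_ran_unique:
  assumes r: "is_ran C H J K \<gamma>" and r': "is_ran C H J K' \<gamma>'"
  shows "\<exists>k \<in> hom2 C K' K. invertible2 C k \<and> \<gamma>' = \<gamma> \<cdot> (k \<triangleleft> H)"
proof -
  note [simp] = is_ranD[OF r] is_ranD[OF r']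
  obtain k where k [simp]: "k \<in> Cell C" "Src C k = K'" "Tgt C k = K" "\<gamma> \<cdot> (k \<triangleleft> H) = \<gamma>'"
    by (rule is_ran_factor[OF r, of K' \<gamma>']) simp_all
  obtain k' where k' [simp]: "k' \<in> Cell C" "Src C k' = K" "Tgt C k' = K'" "\<gamma>' \<cdot> (k' \<triangleleft> H) = \<gamma>"
    by (rule is_ran_factor[OF r', of K \<gamma>]) simp_all
  have "\<gamma> \<cdot> ((k \<cdot> k') \<triangleleft> H) = \<gamma>"
    using VComp_assoc'[of \<gamma> "k \<triangleleft> H" "k' \<triangleleft> H", symmetric] by simp
  then have "\<gamma> \<cdot> ((k \<cdot> k') \<triangleleft> H) = \<gamma> \<cdot> (Id2 C K \<triangleleft> H)"
    by simp
  then have 1: "k \<cdot> k' = Id2 C K"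
    by (rule is_ran_eq[OF r, of _ K, rotated -1]) simp_all
  have "\<gamma>' \<cdot> ((k' \<cdot> k) \<triangleleft> H) = \<gamma>'"
    using VComp_assoc'[of \<gamma>' "k' \<triangleleft> H" "k \<triangleleft> H", symmetric] by simp
  then have "\<gamma>' \<cdot> ((k' \<cdot> k) \<triangleleft> H) = \<gamma>' \<cdot> (Id2 C K' \<triangleleft> H)"
    by simp
  then have 2: "k' \<cdot> k = Id2 C K'"
    by (rule is_ran_eq[OF r', of _ K', rotated -1]) simp_all
  have "inverse2 C k k'"
    using 1 2 by (simp add: inverse2_iff)
  then show ?thesis
    by (intro bexI[of _ k]) (auto simp: invertible2_def hom2_iff)
qed

lemma invertible2_Id2: "f \<in> Mor C \<Longrightarrow> invertible2 C (Id2 C f)"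
  unfolding invertible2_def by (rule exI[of _ "Id2 C f"]) (simp add: inverse2_iff)

text \<open>Preservation may be tested on any one representative of the Kan extension, which turns a
  statement about all representatives into one about a lift that has been constructed.\<close>

lemma preserves_ran_unique:
  assumes r: "is_ran C H J K \<gamma>" and r': "is_ran C H J K' \<gamma>'"
    and G: "G \<in> Mor C" "Dom C G = Cod C J" and p: "preserves_ran C G H J K \<gamma>"
  shows "preserves_ran C G H J K' \<gamma>'"
proof -
  obtain k where k: "k \<in> hom2 C K' K" "invertible2 C k" "\<gamma>' = \<gamma> \<cdot> (k \<triangleleft> H)"
    using is_ran_unique[OF r r'] by blast
  note [simp] = is_ranD[OF r] is_ranD(4-6)[OF r'] hom2D(1-3)[OF k(1)] G
  have "invertible2 C (G \<triangleright> k)"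
    using k(2) inverse2_whiskerL[of k _ G] G by (auto simp: invertible2_def)
  then have "is_ran C H (G \<odot> J) (G \<odot> K') (Id2 C (G \<odot> J) \<cdot> ((G \<triangleright> \<gamma>) \<cdot> ((G \<triangleright> k) \<triangleleft> H)))"
    using p G invertible2_Id2[of "G \<odot> J"] unfolding preserves_ran_def
    by (intro is_ran_transport) (simp_all add: hom2_iff)
  then show ?thesis
    using G by (simp add: preserves_ran_def k(3))
qed

subsection \<open>Equivalences and Kan extensions\<close>

text \<open>By naturality of \<open>a\<close>, whiskering with \<open>T\<close> is conjugation with the components of \<open>a\<close>.\<close>

lemma bij_whiskerL_iso_Id:
  assumes a: "a \<in> hom2 C T (Id C x)" "invertible2 C a"
    and f: "f \<in> Mor C" "Cod C f = x" and g: "g \<in> Mor C" "Cod C g = x" "Dom C g = Dom C f"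
  shows "bij_betw (\<lambda>\<beta>. T \<triangleright> \<beta>) (hom2 C f g) (hom2 C (T \<odot> f) (T \<odot> g))"
proof -
  obtain a' where a': "inverse2 C a a'" using a by (auto simp: invertible2_def)
  have x: "x \<in> Ob C" using f by auto
  note [simp] = hom2D(1-4)[OF a(1)]
  have [simp]: "Cod C T = x" "Dom C T = x"
    using hom2D[OF a(1)] x by simp_all
  have a't [simp]: "a' \<in> Cell C" "Src C a' = Id C x" "Tgt C a' = T"
    using a' by (simp_all add: inverse2_iff)
  have 1: "inverse2 C (a \<triangleleft> f) (a' \<triangleleft> f)" "inverse2 C (a \<triangleleft> g) (a' \<triangleleft> g)"
    using a' f g by (auto intro: inverse2_whiskerR)
  have 2: "inverse2 C (a' \<triangleleft> g) (a \<triangleleft> g)"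
    using 1 by (auto simp: inverse2_iff)
  have "bij_betw ((\<lambda>y. (a' \<triangleleft> g) \<cdot> y) \<circ> (\<lambda>\<beta>. \<beta> \<cdot> (a \<triangleleft> f)))
      (hom2 C f g) (hom2 C (T \<odot> f) (T \<odot> g))"
  proof (rule bij_betw_trans)
    show "bij_betw (\<lambda>\<beta>. \<beta> \<cdot> (a \<triangleleft> f)) (hom2 C f g) (hom2 C (T \<odot> f) g)"
      by (rule bij_VComp_right[OF 1(1)]) (use f x in simp_all)
    show "bij_betw (\<lambda>y. (a' \<triangleleft> g) \<cdot> y) (hom2 C (T \<odot> f) g) (hom2 C (T \<odot> f) (T \<odot> g))"
      by (rule bij_VComp_left[OF 2]) (use g x in simp_all)
  qed
  moreover have "((\<lambda>y. (a' \<triangleleft> g) \<cdot> y) \<circ> (\<lambda>\<beta>. \<beta> \<cdot> (a \<triangleleft> f))) \<beta> = T \<triangleright> \<beta>" if "\<beta> \<in> hom2 C f g" for \<beta>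
  proof -
    have [simp]: "\<beta> \<in> Cell C" "Src C \<beta> = f" "Tgt C \<beta> = g"
      using that by (simp_all add: hom2_iff)
    show ?thesis
      using whisker_natural[of a \<beta>] f g x inverse2_cancel(1)[OF 1(2), of "T \<triangleright> \<beta>"] by simp
  qed
  ultimately show ?thesis
    by (rule bij_betw_cong[THEN iffD1, rotated])
qed

lemma equivalence_inverse:
  assumes "equivalence C E"
  obtains E' a b where "equivalence C E'" "E' \<in> hom C (Cod C E) (Dom C E)"
    "a \<in> hom2 C (E' \<odot> E) (Id C (Dom C E))" "invertible2 C a"
    "b \<in> hom2 C (E \<odot> E') (Id C (Cod C E))" "invertible2 C b"
proof -
  obtain E' a b where *: "E' \<in> hom C (Cod C E) (Dom C E)"
    "a \<in> hom2 C (E' \<odot> E) (Id C (Dom C E))" "invertible2 C a"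
    "b \<in> hom2 C (E \<odot> E') (Id C (Cod C E))" "invertible2 C b" and E: "E \<in> Mor C"
    using assms unfolding equivalence_def by blast
  then have "equivalence C E'"
    unfolding equivalence_def by (auto simp: hom_iff intro!: bexI[of _ E])
  with * show ?thesis by (rule that[rotated])
qed

lemma equivalence_co:
  assumes "equivalence C E"
  shows "equivalence (co C) E"
proof -
  obtain E' a b where *: "E' \<in> hom C (Cod C E) (Dom C E)"
    "a \<in> hom2 C (E' \<odot> E) (Id C (Dom C E))" "invertible2 C a"
    "b \<in> hom2 C (E \<odot> E') (Id C (Cod C E))" "invertible2 C b" and E: "E \<in> Mor C"
    using assms unfolding equivalence_def by blast
  obtain a' b' where "inverse2 C a a'" "inverse2 C b b'"
    using * by (auto simp: invertible2_def)
  then have "a' \<in> hom2 C (Id C (Dom C E)) (E' \<odot> E)" "invertible2 (co C) a'"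
    "b' \<in> hom2 C (Id C (Cod C E)) (E \<odot> E')" "invertible2 (co C) b'"
    using * unfolding invertible2_def inverse2_def by (auto simp: hom2_iff)
  with * E show ?thesis
    unfolding equivalence_def by auto
qed

text \<open>Whiskering with \<open>E' \<odot> E\<close> and with \<open>E \<odot> E'\<close> is bijective; the first makes whiskering with
  \<open>E\<close> injective, the second makes whiskering with \<open>E'\<close> injective on 2-cells between values of
  \<open>E\<close>, and together they give surjectivity.\<close>

lemma equivalence_full_faithful:
  assumes E: "equivalence C E" and f: "f \<in> Mor C" "Cod C f = Dom C E"
    and g: "g \<in> Mor C" "Cod C g = Dom C E" "Dom C g = Dom C f"
  shows "bij_betw (\<lambda>\<beta>. E \<triangleright> \<beta>) (hom2 C f g) (hom2 C (E \<odot> f) (E \<odot> g))"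
proof -
  obtain E' a b where E': "E' \<in> hom C (Cod C E) (Dom C E)"
    and a: "a \<in> hom2 C (E' \<odot> E) (Id C (Dom C E))" "invertible2 C a"
    and b: "b \<in> hom2 C (E \<odot> E') (Id C (Cod C E))" "invertible2 C b"
    using equivalence_inverse[OF E] by metis
  have t [simp]: "E \<in> Mor C" "E' \<in> Mor C" "Dom C E' = Cod C E" "Cod C E' = Dom C E"
    using E E' by (auto simp: equivalence_def hom_iff)
  let ?X = "hom2 C f g" and ?Y = "hom2 C (E \<odot> f) (E \<odot> g)"
  let ?Z = "hom2 C (E' \<odot> (E \<odot> f)) (E' \<odot> (E \<odot> g))"
  let ?W = "hom2 C (E \<odot> (E' \<odot> (E \<odot> f))) (E \<odot> (E' \<odot> (E \<odot> g)))"
  have 1: "bij_betw (\<lambda>\<beta>. E' \<triangleright> (E \<triangleright> \<beta>)) ?X ?Z"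
    using bij_whiskerL_iso_Id[OF a f g] f g
    by (subst bij_betw_cong[where g = "\<lambda>\<beta>. (E' \<odot> E) \<triangleright> \<beta>"]) (auto simp: hom2_iff)
  have 2: "bij_betw (\<lambda>\<beta>. E \<triangleright> (E' \<triangleright> \<beta>)) ?Y ?W"
    using bij_whiskerL_iso_Id[OF b, of "E \<odot> f" "E \<odot> g"] f g
    by (subst bij_betw_cong[where g = "\<lambda>\<beta>. (E \<odot> E') \<triangleright> \<beta>"]) (auto simp: hom2_iff)
  have inj': "inj_on (\<lambda>\<beta>. E' \<triangleright> \<beta>) ?Y"
    using 2 by (auto simp: bij_betw_def inj_on_def)
  have E_hom: "E \<triangleright> \<beta> \<in> ?Y" if "\<beta> \<in> ?X" for \<beta>
    using that f g by (auto simp: hom2_iff)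
  have E'_hom: "E' \<triangleright> \<beta> \<in> ?Z" if "\<beta> \<in> ?Y" for \<beta>
    using that f g by (auto simp: hom2_iff)
  have "inj_on (\<lambda>\<beta>. E \<triangleright> \<beta>) ?X"
    using 1 by (auto simp: bij_betw_def inj_on_def)
  moreover have "\<exists>\<beta>\<in>?X. E \<triangleright> \<beta> = \<alpha>" if "\<alpha> \<in> ?Y" for \<alpha>
  proof -
    have "E' \<triangleright> \<alpha> \<in> (\<lambda>\<beta>. E' \<triangleright> (E \<triangleright> \<beta>)) ` ?X"
      using 1 E'_hom[OF that] by (simp add: bij_betw_def)
    then obtain \<beta> where \<beta>: "\<beta> \<in> ?X" "E' \<triangleright> (E \<triangleright> \<beta>) = E' \<triangleright> \<alpha>" by auto
    with inj' that E_hom[of \<beta>] have "E \<triangleright> \<beta> = \<alpha>" by (auto dest: inj_onD)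
    with \<beta> show ?thesis by blast
  qed
  ultimately show ?thesis
    using E_hom by (auto simp: bij_betw_def)
qed

lemma equivalence_reflects_ran:
  assumes E: "equivalence C E" and J: "J \<in> Mor C" "Cod C J = Dom C E"
    and K: "K \<in> hom C (Cod C H) (Cod C J)" and \<gamma>: "\<gamma> \<in> hom2 C (K \<odot> H) J"
    and r: "is_ran C H (E \<odot> J) (E \<odot> K) (E \<triangleright> \<gamma>)"
  shows "is_ran C H J K \<gamma>"
proof -
  have [simp]: "E \<in> Mor C" using E by (simp add: equivalence_def)
  have [simp]: "K \<in> Mor C" "Dom C K = Cod C H" "Cod C K = Dom C E" "\<gamma> \<in> Cell C"
    "Src C \<gamma> = K \<odot> H" "Tgt C \<gamma> = J"
    using K \<gamma> J by (simp_all add: hom_iff hom2_iff)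
  note [simp] = J is_ranD(1)[OF r]
  have [simp]: "Dom C H = Dom C J"
    using is_ranD(3)[OF r] by simp
  show ?thesis
  proof (rule is_ranI)
    fix R assume "R \<in> Mor C" "Dom C R = Cod C H" "Cod C R = Cod C J"
    then have [simp]: "R \<in> Mor C" "Dom C R = Cod C H" "Cod C R = Dom C E" by simp_all
    have "bij_betw ((\<lambda>\<beta>. (E \<triangleright> \<gamma>) \<cdot> (\<beta> \<triangleleft> H)) \<circ> (\<lambda>\<beta>. E \<triangleright> \<beta>))
        (hom2 C R K) (hom2 C (E \<odot> (R \<odot> H)) (E \<odot> J))"
    proof (rule bij_betw_trans)
      show "bij_betw (\<lambda>\<beta>. E \<triangleright> \<beta>) (hom2 C R K) (hom2 C (E \<odot> R) (E \<odot> K))"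
        by (rule equivalence_full_faithful[OF E]) simp_all
      show "bij_betw (\<lambda>\<beta>. (E \<triangleright> \<gamma>) \<cdot> (\<beta> \<triangleleft> H)) (hom2 C (E \<odot> R) (E \<odot> K))
          (hom2 C (E \<odot> (R \<odot> H)) (E \<odot> J))"
        using is_ran_bij[OF r, of "E \<odot> R"] by simp
    qed
    moreover have "((\<lambda>\<beta>. (E \<triangleright> \<gamma>) \<cdot> (\<beta> \<triangleleft> H)) \<circ> (\<lambda>\<beta>. E \<triangleright> \<beta>)) \<beta> =
        ((\<lambda>\<beta>. E \<triangleright> \<beta>) \<circ> (\<lambda>\<beta>. \<gamma> \<cdot> (\<beta> \<triangleleft> H))) \<beta>" if "\<beta> \<in> hom2 C R K" for \<beta>
      using hom2D(1-3)[OF that] by simp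
    ultimately have "bij_betw ((\<lambda>\<beta>. E \<triangleright> \<beta>) \<circ> (\<lambda>\<beta>. \<gamma> \<cdot> (\<beta> \<triangleleft> H))) (hom2 C R K)
        (hom2 C (E \<odot> (R \<odot> H)) (E \<odot> J))"
      by (rule bij_betw_cong[THEN iffD1, rotated])
    moreover have "bij_betw (\<lambda>\<beta>. E \<triangleright> \<beta>) (hom2 C (R \<odot> H) J) (hom2 C (E \<odot> (R \<odot> H)) (E \<odot> J))"
      by (rule equivalence_full_faithful[OF E]) simp_all
    moreover have "(\<lambda>\<beta>. \<gamma> \<cdot> (\<beta> \<triangleleft> H)) ` hom2 C R K \<subseteq> hom2 C (R \<odot> H) J"
      by (rule image_subsetI) (simp add: hom2_iff)
    ultimately show "bij_betw (\<lambda>\<beta>. \<gamma> \<cdot> (\<beta> \<triangleleft> H)) (hom2 C R K) (hom2 C (R \<odot> H) J)"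
      by (rule bij_betw_comp_iff2[THEN iffD2, rotated 2])
  qed simp_all
qed

text \<open>The image of \<open>(K, \<gamma>)\<close> under \<open>E' \<odot> E\<close> is isomorphic to \<open>(K, \<gamma>)\<close>, hence a Kan extension, and
  the equivalence \<open>E'\<close> reflects it.\<close>

lemma equivalence_preserves_ran:
  assumes E: "equivalence C E" and r: "is_ran C H J K \<gamma>" and JE: "Cod C J = Dom C E"
  shows "is_ran C H (E \<odot> J) (E \<odot> K) (E \<triangleright> \<gamma>)"
proof -
  obtain E' a b where E': "equivalence C E'" "E' \<in> hom C (Cod C E) (Dom C E)"
    and a: "a \<in> hom2 C (E' \<odot> E) (Id C (Dom C E))" "invertible2 C a"
    using equivalence_inverse[OF E] by metis
  obtain a' where a': "inverse2 C a a'" using a by (auto simp: invertible2_def)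
  have [simp]: "E \<in> Mor C" "E' \<in> Mor C" "Dom C E' = Cod C E" "Cod C E' = Dom C E"
    using E E' by (auto simp: equivalence_def hom_iff)
  note [simp] = is_ranD[OF r]
  note [simp] = hom2D(1-3)[OF a(1)]
  have [simp]: "a' \<in> Cell C" "Src C a' = Id C (Dom C E)" "Tgt C a' = E' \<odot> E"
    using a' by (simp_all add: inverse2_iff)
  note [simp] = JE
  have aK: "inverse2 C (a \<triangleleft> K) (a' \<triangleleft> K)" and aJ: "inverse2 C (a \<triangleleft> J) (a' \<triangleleft> J)"
    using a' by (auto intro!: inverse2_whiskerR)
  have a'J: "inverse2 C (a' \<triangleleft> J) (a \<triangleleft> J)"
    using aJ by (auto simp: inverse2_iff)
  have "is_ran C H (E' \<odot> (E \<odot> J)) (E' \<odot> (E \<odot> K)) ((a' \<triangleleft> J) \<cdot> (\<gamma> \<cdot> ((a \<triangleleft> K) \<triangleleft> H)))"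
    using aK a'J by (intro is_ran_transport[OF r]) (auto simp: invertible2_def hom2_iff)
  moreover have "(a' \<triangleleft> J) \<cdot> (\<gamma> \<cdot> ((a \<triangleleft> K) \<triangleleft> H)) = E' \<triangleright> (E \<triangleright> \<gamma>)"
    using whisker_natural[of a \<gamma>] inverse2_cancel(1)[OF aJ, of "E' \<triangleright> (E \<triangleright> \<gamma>)"] by simp
  ultimately show ?thesis
    by (intro equivalence_reflects_ran[OF E'(1), of "E \<odot> J" "E \<odot> K" H])
      (simp_all add: hom_iff hom2_iff)
qed

text \<open>Composing a Kan extension of \<open>E \<odot> J\<close> with a pseudo-inverse \<open>E'\<close> yields one of \<open>J\<close>, after
  correcting by the isomorphism from \<open>E' \<odot> E\<close> to the identity.  The further morphism \<open>G\<close> serves to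
  treat absolute Kan extensions; taking it to be the identity gives the plain case.\<close>

lemma is_ran_counit_iso:
  assumes E: "E \<in> Mor C" "E' \<in> hom C (Cod C E) (Dom C E)"
    and a: "a \<in> hom2 C (E' \<odot> E) (Id C (Dom C E))" "invertible2 C a"
    and J: "J \<in> Mor C" "Cod C J = Dom C E"
    and K: "K \<in> Mor C" "Cod C K = Cod C E"
    and \<gamma>: "\<gamma> \<in> hom2 C (K \<odot> H) (E \<odot> J)"
    and G: "G \<in> Mor C" "Dom C G = Dom C E"
    and r: "is_ran C H (G \<odot> (E' \<odot> (E \<odot> J))) (G \<odot> (E' \<odot> K)) (G \<triangleright> (E' \<triangleright> \<gamma>))"
  shows "is_ran C H (G \<odot> J) (G \<odot> (E' \<odot> K)) (G \<triangleright> ((a \<triangleleft> J) \<cdot> (E' \<triangleright> \<gamma>)))"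
proof -
  obtain a' where a': "inverse2 C a a'" using a by (auto simp: invertible2_def)
  note [simp] = E(1) J K G hom2D(1-3)[OF a(1)] hom2D(1-3)[OF \<gamma>] is_ranD(1)[OF r]
  have [simp]: "E' \<in> Mor C" "Dom C E' = Cod C E" "Cod C E' = Dom C E"
    using E by (simp_all add: hom_iff)
  have [simp]: "Dom C H = Dom C J" "Dom C K = Cod C H"
    using is_ranD(3,5)[OF r] by simp_all
  have "inverse2 C (G \<triangleright> (a \<triangleleft> J)) (G \<triangleright> (a' \<triangleleft> J))"
    using a' by (intro inverse2_whiskerL inverse2_whiskerR) simp_all
  then have "invertible2 C (G \<triangleright> (a \<triangleleft> J))"
    by (auto simp: invertible2_def)
  then have "is_ran C H (G \<odot> J) (G \<odot> (E' \<odot> K))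
      ((G \<triangleright> (a \<triangleleft> J)) \<cdot> ((G \<triangleright> (E' \<triangleright> \<gamma>)) \<cdot> (Id2 C (G \<odot> (E' \<odot> K)) \<triangleleft> H)))"
    by (intro is_ran_transport[OF r] invertible2_Id2) (simp_all add: hom2_iff)
  then show ?thesis by simp
qed

lemma is_ran_of_equivalence:
  assumes E: "equivalence C E" and J: "J \<in> Mor C" "Cod C J = Dom C E"
    and r: "is_ran C H (E \<odot> J) K \<gamma>"
  shows "\<exists>K \<gamma>. is_ran C H J K \<gamma>"
proof -
  obtain E' a where E': "equivalence C E'" "E' \<in> hom C (Cod C E) (Dom C E)"
    and a: "a \<in> hom2 C (E' \<odot> E) (Id C (Dom C E))" "invertible2 C a"
    using equivalence_inverse[OF E] by metis
  have [simp]: "E \<in> Mor C" "E' \<in> Mor C" "Dom C E' = Cod C E" "Cod C E' = Dom C E"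
    using E E' by (auto simp: equivalence_def hom_iff)
  note [simp] = J hom2D(1-3)[OF a(1)] is_ranD(1,4-)[OF r]
  have [simp]: "Dom C H = Dom C J"
    using is_ranD(3)[OF r] by simp
  have "is_ran C H (E' \<odot> (E \<odot> J)) (E' \<odot> K) (E' \<triangleright> \<gamma>)"
    by (rule equivalence_preserves_ran[OF E'(1) r]) simp
  then have "is_ran C H (Id C (Dom C E) \<odot> (E' \<odot> (E \<odot> J))) (Id C (Dom C E) \<odot> (E' \<odot> K))
      (Id C (Dom C E) \<triangleright> (E' \<triangleright> \<gamma>))" by simp
  then have "is_ran C H (Id C (Dom C E) \<odot> J) (Id C (Dom C E) \<odot> (E' \<odot> K))
      (Id C (Dom C E) \<triangleright> ((a \<triangleleft> J) \<cdot> (E' \<triangleright> \<gamma>)))"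
    by (rule is_ran_counit_iso[OF _ E'(2) a, rotated -1]) (simp_all add: hom2_iff)
  then have "is_ran C H J (E' \<odot> K) ((a \<triangleleft> J) \<cdot> (E' \<triangleright> \<gamma>))" by simp
  then show ?thesis by blast
qed

text \<open>A morphism \<open>G\<close> preserves the extension of \<open>J\<close> because \<open>G \<odot> E'\<close> preserves that of \<open>E \<odot> J\<close>.\<close>

lemma is_absolute_ran_of_equivalence:
  assumes E: "equivalence C E" and J: "J \<in> Mor C" "Cod C J = Dom C E"
    and r: "is_absolute_ran C H (E \<odot> J) K \<gamma>"
  shows "\<exists>K \<gamma>. is_absolute_ran C H J K \<gamma>"
proof -
  have r': "is_ran C H (E \<odot> J) K \<gamma>" using r by (simp add: is_absolute_ran_def)
  obtain E' a where E': "E' \<in> hom C (Cod C E) (Dom C E)"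
    and a: "a \<in> hom2 C (E' \<odot> E) (Id C (Dom C E))" "invertible2 C a"
    using equivalence_inverse[OF E] by metis
  have [simp]: "E \<in> Mor C" "E' \<in> Mor C" "Dom C E' = Cod C E" "Cod C E' = Dom C E"
    using E E' by (auto simp: equivalence_def hom_iff)
  note [simp] = J hom2D(1-3)[OF a(1)] is_ranD(1,4-)[OF r']
  have [simp]: "Dom C H = Dom C J"
    using is_ranD(3)[OF r'] by simp
  let ?\<gamma> = "(a \<triangleleft> J) \<cdot> (E' \<triangleright> \<gamma>)"
  have *: "is_ran C H (G \<odot> J) (G \<odot> (E' \<odot> K)) (G \<triangleright> ?\<gamma>)"
    if [simp]: "G \<in> Mor C" "Dom C G = Dom C E" for G
  proof -
    have "preserves_ran C (G \<odot> E') H (E \<odot> J) K \<gamma>"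
      using r by (simp add: is_absolute_ran_def)
    then have "is_ran C H (G \<odot> (E' \<odot> (E \<odot> J))) (G \<odot> (E' \<odot> K)) (G \<triangleright> (E' \<triangleright> \<gamma>))"
      by (simp add: preserves_ran_def)
    then show ?thesis
      by (rule is_ran_counit_iso[OF _ E' a, rotated -1]) (simp_all add: hom2_iff)
  qed
  from *[of "Id C (Dom C E)"] have "is_ran C H J (E' \<odot> K) ?\<gamma>" by simp
  then have "is_absolute_ran C H J (E' \<odot> K) ?\<gamma>"
    using * by (simp add: is_absolute_ran_def preserves_ran_def)
  then show ?thesis by blast
qed

lemma creates_absolute_ran_equivalence_Comp:
  assumes G: "creates_absolute_ran C G" "G \<in> Mor C" and E: "equivalence C E" "Dom C E = Cod C G"
  shows "creates_absolute_ran C (E \<odot> G)"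
  unfolding creates_absolute_ran_def
proof (intro ballI impI)
  fix H J
  assume "H \<in> Mor C" "J \<in> Mor C" "Dom C H = Dom C J" "Cod C J = Dom C (E \<odot> G)"
    and ex: "\<exists>K \<gamma>. is_absolute_ran C H ((E \<odot> G) \<odot> J) K \<gamma>"
  then have [simp]: "H \<in> Mor C" "J \<in> Mor C" "Dom C H = Dom C J" "Cod C J = Dom C G"
    "E \<in> Mor C" and e [simp]: "G \<in> Mor C" "Dom C E = Cod C G"
    using G E by (simp_all add: equivalence_def)
  obtain K \<gamma> where "is_absolute_ran C H (E \<odot> (G \<odot> J)) K \<gamma>"
    using ex by auto
  then have "\<exists>K \<gamma>. is_absolute_ran C H (G \<odot> J) K \<gamma>"
    by (rule is_absolute_ran_of_equivalence[OF E(1), rotated -1]) simp_all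
  then have c: "creates_ran C G H J"
    using G by (simp add: creates_absolute_ran_def)
  have "reflects_ran C (E \<odot> G) H J"
    unfolding reflects_ran_def
  proof (intro ballI impI)
    fix K \<gamma> assume K: "K \<in> hom C (Cod C H) (Cod C J)" and \<gamma>: "\<gamma> \<in> hom2 C (K \<odot> H) J"
      and r: "is_ran C H (E \<odot> G \<odot> J) (E \<odot> G \<odot> K) (E \<odot> G \<triangleright> \<gamma>)"
    have [simp]: "K \<in> Mor C" "Dom C K = Cod C H" "Cod C K = Dom C G" using K by (simp_all add: hom_iff)
    note [simp] = hom2D(1-3)[OF \<gamma>]
    have "is_ran C H (G \<odot> J) (G \<odot> K) (G \<triangleright> \<gamma>)"
    proof (rule equivalence_reflects_ran[OF E(1)])
      show "is_ran C H (E \<odot> (G \<odot> J)) (E \<odot> (G \<odot> K)) (E \<triangleright> (G \<triangleright> \<gamma>))"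
        using r by simp
    qed (simp_all add: hom_iff hom2_iff)
    then show "is_ran C H J K \<gamma>"
      using c K \<gamma> by (simp add: creates_ran_def reflects_ran_def)
  qed
  moreover have "preserves_ran C (E \<odot> G) H J K \<gamma>" if r: "is_ran C H J K \<gamma>" for K \<gamma>
  proof -
    note [simp] = is_ranD(4-)[OF r]
    have "is_ran C H (G \<odot> J) (G \<odot> K) (G \<triangleright> \<gamma>)"
      using r c by (simp add: creates_ran_def preserves_ran_def)
    then have "is_ran C H (E \<odot> (G \<odot> J)) (E \<odot> (G \<odot> K)) (E \<triangleright> (G \<triangleright> \<gamma>))"
      by (rule equivalence_preserves_ran[OF E(1)]) simp
    then show ?thesis by (simp add: preserves_ran_def)
  qed
  ultimately show "creates_ran C (E \<odot> G) H J"
    using c by (simp add: creates_ran_def)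
qed

lemma creates_absolute_ran_Comp_equivalence:
  assumes G: "creates_absolute_ran C G" "G \<in> Mor C" and E: "equivalence C E" "Cod C E = Dom C G"
  shows "creates_absolute_ran C (G \<odot> E)"
  unfolding creates_absolute_ran_def
proof (intro ballI impI)
  fix H J
  assume "H \<in> Mor C" "J \<in> Mor C" "Dom C H = Dom C J" "Cod C J = Dom C (G \<odot> E)"
    and ex: "\<exists>K \<gamma>. is_absolute_ran C H ((G \<odot> E) \<odot> J) K \<gamma>"
  then have [simp]: "H \<in> Mor C" "J \<in> Mor C" "Dom C H = Dom C J" "Cod C J = Dom C E"
    "E \<in> Mor C" and e [simp]: "G \<in> Mor C" "Cod C E = Dom C G"
    using G E by (simp_all add: equivalence_def)
  have "\<exists>K \<gamma>. is_absolute_ran C H (G \<odot> (E \<odot> J)) K \<gamma>"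
    using ex by simp
  then have c: "creates_ran C G H (E \<odot> J)"
    using G by (simp add: creates_absolute_ran_def)
  have "reflects_ran C (G \<odot> E) H J"
    unfolding reflects_ran_def
  proof (intro ballI impI)
    fix K \<gamma> assume K: "K \<in> hom C (Cod C H) (Cod C J)" and \<gamma>: "\<gamma> \<in> hom2 C (K \<odot> H) J"
      and r: "is_ran C H (G \<odot> E \<odot> J) (G \<odot> E \<odot> K) (G \<odot> E \<triangleright> \<gamma>)"
    have [simp]: "K \<in> Mor C" "Dom C K = Cod C H" "Cod C K = Dom C E" using K by (simp_all add: hom_iff)
    note [simp] = hom2D(1-3)[OF \<gamma>]
    have "is_ran C H (G \<odot> (E \<odot> J)) (G \<odot> (E \<odot> K)) (G \<triangleright> (E \<triangleright> \<gamma>))"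
      using r by simp
    then have "is_ran C H (E \<odot> J) (E \<odot> K) (E \<triangleright> \<gamma>)"
      using c by (simp add: creates_ran_def reflects_ran_def hom_iff hom2_iff)
    then show "is_ran C H J K \<gamma>"
      by (rule equivalence_reflects_ran[OF E(1), rotated -1]) (use K \<gamma> in simp_all)
  qed
  moreover have "preserves_ran C (G \<odot> E) H J K \<gamma>" if r: "is_ran C H J K \<gamma>" for K \<gamma>
  proof -
    note [simp] = is_ranD(4-)[OF r]
    have "is_ran C H (E \<odot> J) (E \<odot> K) (E \<triangleright> \<gamma>)"
      by (rule equivalence_preserves_ran[OF E(1) r]) simp
    then show ?thesis
      using c by (simp add: creates_ran_def preserves_ran_def)
  qed
  moreover have "\<exists>K \<gamma>. is_ran C H J K \<gamma>"
    using c is_ran_of_equivalence[OF E(1), of J H] by (auto simp: creates_ran_def)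
  ultimately show "creates_ran C (G \<odot> E) H J"
    by (simp add: creates_ran_def)
qed

end

section \<open>Lax descent\<close>

text \<open>The 1-cells \<open>p0\<close>, \<open>p1\<close>, \<open>q0\<close>, \<open>q1\<close>, \<open>q2\<close>, \<open>s\<close> stand for the images of the cofaces and of the
  codegeneracy, numbered like these, and the 2-cells for the comparison cells that occur in the
  equations of a descent datum.  The cell \<open>\<mu>1\<close> stands for the inverse of the
  comparison cell from \<open>s \<odot> p1\<close> to the identity: with the inverse as a primitive, reversing the
  2-cells exchanges \<open>\<nu>0\<close> and \<open>\<mu>1\<close>, just as it exchanges \<open>\<sigma>01\<close> and \<open>\<sigma>12\<close>.\<close>

locale descent_shape = two_category C
  for C :: "('x, 'f, 'c, 'z) pre2cat_scheme" (structure) +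
  fixes p0 p1 q0 q1 q2 s :: 'f and \<sigma>01 \<sigma>02 \<sigma>12 \<nu>0 \<mu>1 :: 'c
  assumes p0_Mor: "p0 \<in> Mor C" and q0_Mor: "q0 \<in> Mor C" "Dom C q0 = Cod C p0"
    and p1_hom: "p1 \<in> hom C (Dom C p0) (Cod C p0)"
    and q1_hom: "q1 \<in> hom C (Cod C p0) (Cod C q0)"
    and q2_hom: "q2 \<in> hom C (Cod C p0) (Cod C q0)"
    and s_hom: "s \<in> hom C (Cod C p0) (Dom C p0)"
    and \<sigma>01_hom2: "\<sigma>01 \<in> hom2 C (q1 \<odot> p0) (q0 \<odot> p0)"
    and \<sigma>02_hom2: "\<sigma>02 \<in> hom2 C (q2 \<odot> p0) (q0 \<odot> p1)"
    and \<sigma>12_hom2: "\<sigma>12 \<in> hom2 C (q2 \<odot> p1) (q1 \<odot> p1)"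
    and \<nu>0_hom2: "\<nu>0 \<in> hom2 C (s \<odot> p0) (Id C (Dom C p0))"
    and \<mu>1_hom2: "\<mu>1 \<in> hom2 C (Id C (Dom C p0)) (s \<odot> p1)"
begin

lemma shape_simps [simp]:
  "p0 \<in> Mor C" "p1 \<in> Mor C" "Dom C p1 = Dom C p0" "Cod C p1 = Cod C p0"
  "q0 \<in> Mor C" "q1 \<in> Mor C" "q2 \<in> Mor C"
  "Dom C q0 = Cod C p0" "Dom C q1 = Cod C p0" "Dom C q2 = Cod C p0"
  "Cod C q1 = Cod C q0" "Cod C q2 = Cod C q0"
  "s \<in> Mor C" "Dom C s = Cod C p0" "Cod C s = Dom C p0"
  "\<sigma>01 \<in> Cell C" "Src C \<sigma>01 = q1 \<odot> p0" "Tgt C \<sigma>01 = q0 \<odot> p0"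
  "\<sigma>02 \<in> Cell C" "Src C \<sigma>02 = q2 \<odot> p0" "Tgt C \<sigma>02 = q0 \<odot> p1"
  "\<sigma>12 \<in> Cell C" "Src C \<sigma>12 = q2 \<odot> p1" "Tgt C \<sigma>12 = q1 \<odot> p1"
  "\<nu>0 \<in> Cell C" "Src C \<nu>0 = s \<odot> p0" "Tgt C \<nu>0 = Id C (Dom C p0)"
  "\<mu>1 \<in> Cell C" "Src C \<mu>1 = Id C (Dom C p0)" "Tgt C \<mu>1 = s \<odot> p1"
  using p0_Mor q0_Mor p1_hom q1_hom q2_hom s_hom \<sigma>01_hom2 \<sigma>02_hom2 \<sigma>12_hom2 \<nu>0_hom2 \<mu>1_hom2
  by (simp_all add: hom_iff hom2_iff)

definition datum :: "'f \<Rightarrow> 'c \<Rightarrow> bool" where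
  "datum F \<beta> \<longleftrightarrow> F \<in> Mor C \<and> Cod C F = Dom C p0 \<and> \<beta> \<in> hom2 C (p1 \<odot> F) (p0 \<odot> F) \<and>
    (\<sigma>01 \<triangleleft> F) \<cdot> ((q1 \<triangleright> \<beta>) \<cdot> (\<sigma>12 \<triangleleft> F)) = (q0 \<triangleright> \<beta>) \<cdot> ((\<sigma>02 \<triangleleft> F) \<cdot> (q2 \<triangleright> \<beta>)) \<and>
    (\<nu>0 \<triangleleft> F) \<cdot> ((s \<triangleright> \<beta>) \<cdot> (\<mu>1 \<triangleleft> F)) = Id2 C F"

lemma descent_shape_co:
  "descent_shape (co C) p1 p0 q2 q1 q0 s \<sigma>12 \<sigma>02 \<sigma>01 \<mu>1 \<nu>0"
  by (intro descent_shape.intro descent_shape_axioms.intro two_category_co)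
    (simp_all add: hom_iff hom2_iff)

text \<open>Reversing 2-cells turns the left side of the cocycle equation into the composite of the same
  three cells in the opposite order, which is again its left side once \<open>0\<close> and \<open>2\<close> are exchanged
  among the \<open>q\<close>'s and \<open>0\<close> and \<open>1\<close> among the \<open>p\<close>'s.  The same holds for the right side and for the unit equation.\<close>

lemma datum_co:
  "descent_shape.datum (co C) p1 p0 q2 q1 q0 s \<sigma>12 \<sigma>02 \<sigma>01 \<mu>1 \<nu>0 F \<beta> \<longleftrightarrow> datum F \<beta>"
  by (auto simp: descent_shape.datum_def[OF descent_shape_co] datum_def hom2_iff)

end

locale lax_descent = descent_shape C p0 p1 q0 q1 q2 s \<sigma>01 \<sigma>02 \<sigma>12 \<nu>0 \<mu>1
  for C :: "('x, 'f, 'c, 'z) pre2cat_scheme" (structure)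
    and p0 p1 q0 q1 q2 s \<sigma>01 \<sigma>02 \<sigma>12 \<nu>0 \<mu>1 +
  fixes d :: 'f and \<psi> :: 'c
  assumes d_datum: "datum d \<psi>"
    and lift_datum: "datum F \<beta> \<Longrightarrow> \<exists>F'. F' \<in> hom C (Dom C F) (Dom C d) \<and> d \<odot> F' = F \<and> \<psi> \<triangleleft> F' = \<beta>"
    and lift_cell: "F1 \<in> hom C S (Dom C d) \<Longrightarrow> F0 \<in> hom C S (Dom C d) \<Longrightarrow>
      \<xi> \<in> hom2 C (d \<odot> F1) (d \<odot> F0) \<Longrightarrow>
      (\<psi> \<triangleleft> F0) \<cdot> (p1 \<triangleright> \<xi>) = (p0 \<triangleright> \<xi>) \<cdot> (\<psi> \<triangleleft> F1) \<Longrightarrow>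
      \<exists>!\<xi>'. \<xi>' \<in> hom2 C F1 F0 \<and> d \<triangleright> \<xi>' = \<xi>"
begin

lemma d_simps [simp]:
  "d \<in> Mor C" "Cod C d = Dom C p0" "\<psi> \<in> Cell C" "Src C \<psi> = p1 \<odot> d" "Tgt C \<psi> = p0 \<odot> d"
  using d_datum by (simp_all add: datum_def hom2_iff)

lemma lax_descent_co: "lax_descent (co C) p1 p0 q2 q1 q0 s \<sigma>12 \<sigma>02 \<sigma>01 \<mu>1 \<nu>0 d \<psi>"
proof (intro lax_descent.intro descent_shape_co lax_descent_axioms.intro, unfold datum_co, goal_cases)
  case (3 F1 S F0 \<xi>)
  then show ?case using lift_cell[of F0 S F1 \<xi>] by simp
qed (use d_datum lift_datum in simp_all)

lemma \<psi>_natural: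
  assumes "\<gamma> \<in> Cell C" "Cod C (Src C \<gamma>) = Dom C d"
  shows "(p0 \<triangleright> (d \<triangleright> \<gamma>)) \<cdot> (\<psi> \<triangleleft> Src C \<gamma>) = (\<psi> \<triangleleft> Tgt C \<gamma>) \<cdot> (p1 \<triangleright> (d \<triangleright> \<gamma>))"
  using whisker_natural[of \<psi> \<gamma>] assms by simp

text \<open>Every \<open>d \<triangleright> \<xi>\<close> is compatible with \<open>\<psi>\<close> by naturality, so the uniqueness part of \<open>lift_cell\<close>
  applies to it.\<close>

lemma forgetful_faithful:
  assumes "\<xi> \<in> hom2 C F1 F0" "\<xi>' \<in> hom2 C F1 F0" "F1 \<in> Mor C" "Cod C F1 = Dom C d"
    and "d \<triangleright> \<xi> = d \<triangleright> \<xi>'"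
  shows "\<xi> = \<xi>'"
proof -
  note [simp] = hom2D[OF assms(1)] assms(4)
  have "\<exists>!\<xi>''. \<xi>'' \<in> hom2 C F1 F0 \<and> d \<triangleright> \<xi>'' = d \<triangleright> \<xi>"
    by (rule lift_cell[of _ "Dom C F1"]) (use \<psi>_natural[of \<xi>] in \<open>simp_all add: hom_iff hom2_iff\<close>)
  then show ?thesis
    using assms by metis
qed

text \<open>Factorizations through \<open>(d K, d \<gamma>)\<close> lift to \<open>L\<close> because they are compatible with \<open>\<psi>\<close>; the
  compatibility is an equation between 2-cells into \<open>p0 d K\<close>, which is where preservation by \<open>p0\<close>
  enters.\<close>

lemma forgetful_lifts_ran:
  assumes J: "J \<in> Mor C" "Cod C J = Dom C d" and K: "K \<in> Mor C" "Cod C K = Dom C d"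
    and \<gamma>: "\<gamma> \<in> hom2 C (K \<odot> H) J"
    and r: "is_ran C H (d \<odot> J) (d \<odot> K) (d \<triangleright> \<gamma>)"
    and pr: "is_ran C H (p0 \<odot> (d \<odot> J)) (p0 \<odot> (d \<odot> K)) (p0 \<triangleright> (d \<triangleright> \<gamma>))"
  shows "is_ran C H J K \<gamma>"
proof (rule is_ranI)
  note [simp] = J K hom2D(1-3)[OF \<gamma>] is_ranD(1)[OF r]
  have [simp]: "Dom C H = Dom C J" "Dom C K = Cod C H"
    using is_ranD(3,5)[OF r] by simp_all
  show "H \<in> Mor C" "J \<in> Mor C" "Dom C H = Dom C J" "K \<in> Mor C" "Dom C K = Cod C H"
    "Cod C K = Cod C J" "\<gamma> \<in> Cell C" "Src C \<gamma> = K \<odot> H" "Tgt C \<gamma> = J" by simp_all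
  fix R assume "R \<in> Mor C" "Dom C R = Cod C H" "Cod C R = Cod C J"
  then have [simp]: "R \<in> Mor C" "Dom C R = Cod C H" "Cod C R = Dom C d" by simp_all
  have "\<beta> = \<beta>'" if \<beta>: "\<beta> \<in> hom2 C R K" "\<beta>' \<in> hom2 C R K" and eq: "\<gamma> \<cdot> (\<beta> \<triangleleft> H) = \<gamma> \<cdot> (\<beta>' \<triangleleft> H)" for \<beta> \<beta>'
  proof (rule forgetful_faithful[OF \<beta>])
    note [simp] = hom2D(1-3)[OF \<beta>(1)] hom2D(1-3)[OF \<beta>(2)]
    have "d \<triangleright> (\<gamma> \<cdot> (\<beta> \<triangleleft> H)) = d \<triangleright> (\<gamma> \<cdot> (\<beta>' \<triangleleft> H))"
      using eq by simp
    then have "(d \<triangleright> \<gamma>) \<cdot> ((d \<triangleright> \<beta>) \<triangleleft> H) = (d \<triangleright> \<gamma>) \<cdot> ((d \<triangleright> \<beta>') \<triangleleft> H)"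
      by simp
    then show "d \<triangleright> \<beta> = d \<triangleright> \<beta>'"
      by (rule is_ran_eq[OF r, of _ "d \<odot> R", rotated -1]) simp_all
  qed simp_all
  moreover have "\<exists>\<beta>\<in>hom2 C R K. \<gamma> \<cdot> (\<beta> \<triangleleft> H) = \<alpha>" if \<alpha>: "\<alpha> \<in> hom2 C (R \<odot> H) J" for \<alpha>
  proof -
    note [simp] = hom2D(1-3)[OF \<alpha>]
    obtain \<xi> where \<xi> [simp]: "\<xi> \<in> Cell C" "Src C \<xi> = d \<odot> R" "Tgt C \<xi> = d \<odot> K"
      and \<xi>_eq: "(d \<triangleright> \<gamma>) \<cdot> (\<xi> \<triangleleft> H) = d \<triangleright> \<alpha>"
      by (rule is_ran_factor[OF r, of "d \<odot> R" "d \<triangleright> \<alpha>"]) simp_all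
    have p\<xi>: "(p \<triangleright> (d \<triangleright> \<gamma>)) \<cdot> (p \<triangleright> (\<xi> \<triangleleft> H)) = p \<triangleright> (d \<triangleright> \<alpha>)" if "p \<in> Mor C" "Dom C p = Dom C p0" for p
      using arg_cong[OF \<xi>_eq, of "\<lambda>x. p \<triangleright> x"] that by simp
    \<comment> \<open>Pasted with \<open>p0 d \<gamma>\<close>, both composites become \<open>\<psi> J \<cdot> p1 d \<alpha> = p0 d \<alpha> \<cdot> \<psi> R H\<close>.\<close>
    have "(p0 \<triangleright> (d \<triangleright> \<gamma>)) \<cdot> (((\<psi> \<triangleleft> K) \<triangleleft> H) \<cdot> (p1 \<triangleright> (\<xi> \<triangleleft> H))) =
        (\<psi> \<triangleleft> J) \<cdot> ((p1 \<triangleright> (d \<triangleright> \<gamma>)) \<cdot> (p1 \<triangleright> (\<xi> \<triangleleft> H)))"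
      by (rule VComp_eq_extend) (use \<psi>_natural[of \<gamma>] in simp_all)
    also have "\<dots> = (p0 \<triangleright> (d \<triangleright> \<alpha>)) \<cdot> ((\<psi> \<triangleleft> R) \<triangleleft> H)"
      using \<psi>_natural[of \<alpha>] p\<xi>[of p1] by simp
    also have "\<dots> = (p0 \<triangleright> (d \<triangleright> \<gamma>)) \<cdot> ((p0 \<triangleright> (\<xi> \<triangleleft> H)) \<cdot> ((\<psi> \<triangleleft> R) \<triangleleft> H))"
      using p\<xi>[of p0, symmetric] by simp
    finally have "(p0 \<triangleright> (d \<triangleright> \<gamma>)) \<cdot> (((\<psi> \<triangleleft> K) \<cdot> (p1 \<triangleright> \<xi>)) \<triangleleft> H) =
        (p0 \<triangleright> (d \<triangleright> \<gamma>)) \<cdot> (((p0 \<triangleright> \<xi>) \<cdot> (\<psi> \<triangleleft> R)) \<triangleleft> H)"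
      by simp
    then have "(\<psi> \<triangleleft> K) \<cdot> (p1 \<triangleright> \<xi>) = (p0 \<triangleright> \<xi>) \<cdot> (\<psi> \<triangleleft> R)"
      by (rule is_ran_eq[OF pr, of _ "p1 \<odot> (d \<odot> R)", rotated -1]) simp_all
    then obtain \<beta> where \<beta>: "\<beta> \<in> hom2 C R K" "d \<triangleright> \<beta> = \<xi>"
      using lift_cell[of R "Cod C H" K \<xi>] by (auto simp: hom_iff hom2_iff)
    note [simp] = hom2D(1-3)[OF \<beta>(1)]
    have "\<gamma> \<cdot> (\<beta> \<triangleleft> H) = \<alpha>"
      by (rule forgetful_faithful[of _ "R \<odot> H" J]) (use \<xi>_eq \<beta>(2) in \<open>simp_all add: hom2_iff flip: whiskerL_whiskerR\<close>)
    with \<beta> show ?thesis by blast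
  qed
  ultimately show "bij_betw (\<lambda>\<beta>. \<gamma> \<cdot> (\<beta> \<triangleleft> H)) (hom2 C R K) (hom2 C (R \<odot> H) J)"
    by (intro bij_betw_imageI inj_onI subset_antisym image_subsetI subsetI)
      (simp_all add: hom2_iff image_iff Bex_def, blast)
qed

text \<open>The datum \<open>\<phi>\<close> on \<open>K\<close> comes from the universal property of \<open>p0 K\<close>.  Its cocycle equation is
  checked in \<open>q0 p0 K\<close> and its unit equation in \<open>K\<close>, where pasting with \<open>\<gamma>\<close> reduces them to the
  equations of \<open>\<psi>\<close>.\<close>

lemma forgetful_lifts_ran_cell:
  assumes J: "J \<in> Mor C" "Cod C J = Dom C d"
    and r: "is_ran C H (d \<odot> J) K \<gamma>"
    and pr: "is_ran C H (p0 \<odot> (d \<odot> J)) (p0 \<odot> K) (p0 \<triangleright> \<gamma>)"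
    and qr: "is_ran C H (q0 \<odot> (p0 \<odot> (d \<odot> J))) (q0 \<odot> (p0 \<odot> K)) (q0 \<triangleright> (p0 \<triangleright> \<gamma>))"
  obtains K' \<gamma>' where "K' \<in> hom C (Cod C H) (Dom C d)" "d \<odot> K' = K"
    "\<gamma>' \<in> hom2 C (K' \<odot> H) J" "d \<triangleright> \<gamma>' = \<gamma>"
proof -
  note [simp] = J is_ranD(1,4-)[OF r]
  have [simp]: "Dom C H = Dom C J"
    using is_ranD(3)[OF r] by simp
  obtain \<phi> where \<phi> [simp]: "\<phi> \<in> Cell C" "Src C \<phi> = p1 \<odot> K" "Tgt C \<phi> = p0 \<odot> K"
    and \<phi>_eq: "(p0 \<triangleright> \<gamma>) \<cdot> (\<phi> \<triangleleft> H) = (\<psi> \<triangleleft> J) \<cdot> (p1 \<triangleright> \<gamma>)"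
    by (rule is_ran_factor[OF pr, of "p1 \<odot> K" "(\<psi> \<triangleleft> J) \<cdot> (p1 \<triangleright> \<gamma>)"]) simp_all
  have q\<phi>: "(q \<triangleright> (p0 \<triangleright> \<gamma>)) \<cdot> (q \<triangleright> (\<phi> \<triangleleft> H)) = (q \<triangleright> (\<psi> \<triangleleft> J)) \<cdot> (q \<triangleright> (p1 \<triangleright> \<gamma>))"
    if "q \<in> Mor C" "Dom C q = Cod C p0" for q
    using arg_cong[OF \<phi>_eq, of "\<lambda>x. q \<triangleright> x"] that by simp
  note q\<phi>' = VComp_eq_extend[OF q\<phi>]
  \<comment> \<open>As rewrite rules, the equation for \<open>\<phi>\<close> and the naturality equations move \<open>\<gamma>\<close> to the right end
    of a chain, turning \<open>\<phi> H\<close> into \<open>\<psi> J\<close> and components at \<open>K H\<close> into components at \<open>d J\<close>.\<close>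
  have n01: "(q0 \<triangleright> (p0 \<triangleright> \<gamma>)) \<cdot> (\<sigma>01 \<triangleleft> K \<triangleleft> H) = (\<sigma>01 \<triangleleft> d \<triangleleft> J) \<cdot> (q1 \<triangleright> (p0 \<triangleright> \<gamma>))"
    using whisker_natural[of \<sigma>01 \<gamma>] by simp
  have n02: "(q0 \<triangleright> (p1 \<triangleright> \<gamma>)) \<cdot> (\<sigma>02 \<triangleleft> K \<triangleleft> H) = (\<sigma>02 \<triangleleft> d \<triangleleft> J) \<cdot> (q2 \<triangleright> (p0 \<triangleright> \<gamma>))"
    using whisker_natural[of \<sigma>02 \<gamma>] by simp
  have n12: "(q1 \<triangleright> (p1 \<triangleright> \<gamma>)) \<cdot> (\<sigma>12 \<triangleleft> K \<triangleleft> H) = (\<sigma>12 \<triangleleft> d \<triangleleft> J) \<cdot> (q2 \<triangleright> (p1 \<triangleright> \<gamma>))"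
    using whisker_natural[of \<sigma>12 \<gamma>] by simp
  have n0: "\<gamma> \<cdot> (\<nu>0 \<triangleleft> K \<triangleleft> H) = (\<nu>0 \<triangleleft> d \<triangleleft> J) \<cdot> (s \<triangleright> (p0 \<triangleright> \<gamma>))"
    using whisker_natural[of \<nu>0 \<gamma>] by simp
  have n1: "(s \<triangleright> (p1 \<triangleright> \<gamma>)) \<cdot> (\<mu>1 \<triangleleft> K \<triangleleft> H) = (\<mu>1 \<triangleleft> d \<triangleleft> J) \<cdot> \<gamma>"
    using whisker_natural[of \<mu>1 \<gamma>] by simp
  have "(q0 \<triangleright> (p0 \<triangleright> \<gamma>)) \<cdot> (((\<sigma>01 \<triangleleft> K) \<cdot> ((q1 \<triangleright> \<phi>) \<cdot> (\<sigma>12 \<triangleleft> K))) \<triangleleft> H) =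
      (((\<sigma>01 \<triangleleft> d) \<cdot> ((q1 \<triangleright> \<psi>) \<cdot> (\<sigma>12 \<triangleleft> d))) \<triangleleft> J) \<cdot> (q2 \<triangleright> (p1 \<triangleright> \<gamma>))"
    by (simp add: q\<phi>' n12 VComp_eq_extend[OF n01])
  also have "\<dots> = (((q0 \<triangleright> \<psi>) \<cdot> ((\<sigma>02 \<triangleleft> d) \<cdot> (q2 \<triangleright> \<psi>))) \<triangleleft> J) \<cdot> (q2 \<triangleright> (p1 \<triangleright> \<gamma>))"
    using d_datum by (simp only: datum_def)
  also have "\<dots> = (q0 \<triangleright> (p0 \<triangleright> \<gamma>)) \<cdot> (((q0 \<triangleright> \<phi>) \<cdot> ((\<sigma>02 \<triangleleft> K) \<cdot> (q2 \<triangleright> \<phi>))) \<triangleleft> H)"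
    by (simp add: q\<phi> q\<phi>' VComp_eq_extend[OF n02])
  finally have cocycle: "(\<sigma>01 \<triangleleft> K) \<cdot> ((q1 \<triangleright> \<phi>) \<cdot> (\<sigma>12 \<triangleleft> K)) = (q0 \<triangleright> \<phi>) \<cdot> ((\<sigma>02 \<triangleleft> K) \<cdot> (q2 \<triangleright> \<phi>))"
    by (rule is_ran_eq[OF qr, of _ "q2 \<odot> (p1 \<odot> K)", rotated -1]) simp_all
  have "\<gamma> \<cdot> (((\<nu>0 \<triangleleft> K) \<cdot> ((s \<triangleright> \<phi>) \<cdot> (\<mu>1 \<triangleleft> K))) \<triangleleft> H) =
      (((\<nu>0 \<triangleleft> d) \<cdot> ((s \<triangleright> \<psi>) \<cdot> (\<mu>1 \<triangleleft> d))) \<triangleleft> J) \<cdot> \<gamma>"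
    by (simp add: q\<phi>' n1 VComp_eq_extend[OF n0])
  also have "\<dots> = (Id2 C d \<triangleleft> J) \<cdot> \<gamma>"
    using d_datum by (simp only: datum_def)
  also have "\<dots> = \<gamma> \<cdot> (Id2 C K \<triangleleft> H)"
    by simp
  finally have unit: "(\<nu>0 \<triangleleft> K) \<cdot> ((s \<triangleright> \<phi>) \<cdot> (\<mu>1 \<triangleleft> K)) = Id2 C K"
    by (rule is_ran_eq[OF r, of _ K, rotated -1]) simp_all
  have "datum K \<phi>"
    using cocycle unit by (simp add: datum_def hom2_iff)
  then obtain K' where K': "K' \<in> hom C (Cod C H) (Dom C d)" "d \<odot> K' = K" "\<psi> \<triangleleft> K' = \<phi>"
    using lift_datum[of K \<phi>] by auto
  have [simp]: "K' \<in> Mor C" "Dom C K' = Cod C H" "Cod C K' = Dom C d"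
    using K'(1) by (simp_all add: hom_iff)
  have "\<exists>!\<gamma>'. \<gamma>' \<in> hom2 C (K' \<odot> H) J \<and> d \<triangleright> \<gamma>' = \<gamma>"
  proof (rule lift_cell[of _ "Dom C J"])
    show "\<gamma> \<in> hom2 C (d \<odot> (K' \<odot> H)) (d \<odot> J)"
      using K'(2) by (simp add: hom2_iff flip: Comp_assoc')
    show "(\<psi> \<triangleleft> J) \<cdot> (p1 \<triangleright> \<gamma>) = (p0 \<triangleright> \<gamma>) \<cdot> (\<psi> \<triangleleft> (K' \<odot> H))"
      using K'(3) \<phi>_eq by simp
  qed (simp_all add: hom_iff)
  then obtain \<gamma>' where "\<gamma>' \<in> hom2 C (K' \<odot> H) J" "d \<triangleright> \<gamma>' = \<gamma>"
    by blast
  then show ?thesis by (rule that[OF K'(1,2)])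
qed

theorem forgetful_creates_absolute_ran: "creates_absolute_ran C d"
  unfolding creates_absolute_ran_def
proof (intro ballI impI)
  fix H J
  assume H: "H \<in> Mor C" and J: "J \<in> Mor C" "Cod C J = Dom C d" and HJ: "Dom C H = Dom C J"
    and "\<exists>K \<gamma>. is_absolute_ran C H (d \<odot> J) K \<gamma>"
  then obtain K \<gamma> where r: "is_ran C H (d \<odot> J) K \<gamma>"
    and abs: "\<And>G. G \<in> Mor C \<Longrightarrow> Dom C G = Cod C K \<Longrightarrow> preserves_ran C G H (d \<odot> J) K \<gamma>"
    by (auto simp: is_absolute_ran_def)
  note [simp] = H J HJ is_ranD(4-)[OF r]
  have lifts: "is_ran C H J K0 \<gamma>0"
    if K0: "K0 \<in> hom C (Cod C H) (Cod C J)" and \<gamma>0: "\<gamma>0 \<in> hom2 C (K0 \<odot> H) J"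
      and r0: "is_ran C H (d \<odot> J) (d \<odot> K0) (d \<triangleright> \<gamma>0)" for K0 \<gamma>0
  proof (rule forgetful_lifts_ran[OF J _ _ \<gamma>0 r0])
    have "preserves_ran C p0 H (d \<odot> J) (d \<odot> K0) (d \<triangleright> \<gamma>0)"
      by (rule preserves_ran_unique[OF r r0 _ _ abs]) simp_all
    then show "is_ran C H (p0 \<odot> (d \<odot> J)) (p0 \<odot> (d \<odot> K0)) (p0 \<triangleright> (d \<triangleright> \<gamma>0))"
      by (simp add: preserves_ran_def)
  qed (use K0 in \<open>simp_all add: hom_iff\<close>)
  have pr: "is_ran C H (p0 \<odot> (d \<odot> J)) (p0 \<odot> K) (p0 \<triangleright> \<gamma>)"
    using abs[of p0] by (simp add: preserves_ran_def)
  have qr: "is_ran C H (q0 \<odot> (p0 \<odot> (d \<odot> J))) (q0 \<odot> (p0 \<odot> K)) (q0 \<triangleright> (p0 \<triangleright> \<gamma>))"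
    using abs[of "q0 \<odot> p0"] by (simp add: preserves_ran_def)
  obtain K' \<gamma>' where K': "K' \<in> hom C (Cod C H) (Cod C J)" "d \<odot> K' = K"
    "\<gamma>' \<in> hom2 C (K' \<odot> H) J" "d \<triangleright> \<gamma>' = \<gamma>"
    using forgetful_lifts_ran_cell[OF J r pr qr] J by metis
  have r': "is_ran C H J K' \<gamma>'"
    by (rule lifts) (use K' r in simp_all)
  have p': "preserves_ran C d H J K' \<gamma>'"
    using r K' by (simp add: preserves_ran_def)
  show "creates_ran C d H J"
    unfolding creates_ran_def reflects_ran_def
    using lifts r' preserves_ran_unique[OF r' _ _ _ p'] J d_simps(1) by metis
qed

end

section \<open>Lax descent objects of pseudofunctors\<close>

context two_category
begin

lemma invertible2_inv2:
  assumes "invertible2 C a" "a \<in> hom2 C f g"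
  shows "invertible2 C (inv2 C a)" "inv2 C a \<in> hom2 C g f"
  using inverse2_inv2[OF assms(1)] assms(2) by (auto simp: invertible2_def inverse2_iff hom2_iff)

lemma invertible2_VComp:
  assumes "invertible2 C b" "invertible2 C a" "a \<in> hom2 C f g" "b \<in> hom2 C g h"
  shows "invertible2 C (b \<cdot> a)"
proof -
  obtain a' b' where i: "inverse2 C a a'" "inverse2 C b b'"
    using assms by (auto simp: invertible2_def)
  then have [simp]: "a \<in> Cell C" "b \<in> Cell C" "Src C b = Tgt C a" "a' \<in> Cell C" "b' \<in> Cell C"
    "Src C a' = Tgt C a" "Tgt C a' = Src C a" "Src C b' = Tgt C b" "Tgt C b' = Tgt C a"
    "a' \<cdot> a = Id2 C (Src C a)" "b \<cdot> b' = Id2 C (Tgt C b)"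
    using assms by (simp_all add: inverse2_iff hom2_iff)
  have "inverse2 C (b \<cdot> a) (a' \<cdot> b')"
    using inverse2_cancel(1)[OF i(2), of a] inverse2_cancel(2)[OF i(1), of b']
    by (simp add: inverse2_iff)
  then show ?thesis by (auto simp: invertible2_def)
qed

end

text \<open>The pseudofunctor supplies the types of the comparison cells: by the cosimplicial relations
  the composition constraints involved have a common target, so that one can be followed by the
  inverse of the other.\<close>

lemma lax_descent_object_imp_lax_descent:
  assumes "pseudofunctor Delta3 C A" and L: "lax_descent_object C A L d \<psi>"
  shows "lax_descent C (FMor A (cd 0)) (FMor A (cd 1)) (FMor A (cD 0)) (FMor A (cD 1)) (FMor A (cD 2))
    (FMor A cs0) (sigma01 C A) (sigma02 C A) (sigma12 C A) (nu0 C A) (inv2 C (nu1 C A)) d \<psi>"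
proof -
  interpret P: pseudofunctor Delta3 C A by fact
  have cd: "cd i \<in> hom Delta3 1 2" if "i \<in> {0, 1}" for i
    using Delta3_arrows.intros(2)[OF that] by (simp add: hom_def Delta3_def coface_def)
  have cD: "cD i \<in> hom Delta3 2 3" if "i \<in> {0, 1, 2}" for i
    using Delta3_arrows.intros(4)[OF that] by (simp add: hom_def Delta3_def coface_def)
  have cs: "cs0 \<in> hom Delta3 2 1"
    using Delta3_arrows.intros(3) by (simp add: hom_def Delta3_def cs0_def)
  have one: "1 \<in> Ob Delta3" by (simp add: Delta3_def)
  have D3: "Comp Delta3 = ocomp" "Id Delta3 = oid" by (simp_all add: Delta3_def)
  have rel: "ocomp (cD 1) (cd 0) = ocomp (cD 0) (cd 0)" "ocomp (cD 2) (cd 0) = ocomp (cD 0) (cd 1)"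
    "ocomp (cD 2) (cd 1) = ocomp (cD 1) (cd 1)"
    using Delta3_relations(3)[of 0 1] Delta3_relations(3)[of 0 2] Delta3_relations(3)[of 1 2]
    by simp_all
  have \<sigma>: "inv2 C (FComp A (cD i) (cd j)) \<cdot>\<^bsub>C\<^esub> FComp A (cD i') (cd j') \<in>
      hom2 C (FMor A (cD i') \<odot>\<^bsub>C\<^esub> FMor A (cd j')) (FMor A (cD i) \<odot>\<^bsub>C\<^esub> FMor A (cd j))"
    if "ocomp (cD i') (cd j') = ocomp (cD i) (cd j)" "i \<in> {0, 1, 2}" "i' \<in> {0, 1, 2}" "j \<in> {0, 1}" "j' \<in> {0, 1}"
    for i j i' j'
    using P.FComp_hom2[OF cD[OF that(2)] cd[OF that(4)]] P.FComp_hom2[OF cD[OF that(3)] cd[OF that(5)]]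
      P.FComp_invertible[OF cD[OF that(2)] cd[OF that(4)]] that(1)
    by (auto simp: D3 intro: P.VComp_hom2 P.invertible2_inv2)
  note u = P.FUnit_hom2[OF one] P.FUnit_invertible[OF one]
  note iu = P.invertible2_inv2[OF u(2,1)]
  have \<nu>: "inv2 C (FUnit A 1) \<cdot>\<^bsub>C\<^esub> FComp A cs0 (cd j) \<in> hom2 C (FMor A cs0 \<odot>\<^bsub>C\<^esub> FMor A (cd j)) (Id C (FOb A 1))"
    "invertible2 C (inv2 C (FUnit A 1) \<cdot>\<^bsub>C\<^esub> FComp A cs0 (cd j))"
    if "j \<in> {0, 1}" for j
  proof -
    have "ocomp cs0 (cd j) = oid 1" using that Delta3_relations(1,2) by auto
    then have c: "FComp A cs0 (cd j) \<in> hom2 C (FMor A cs0 \<odot>\<^bsub>C\<^esub> FMor A (cd j)) (FMor A (Id Delta3 1))"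
      using P.FComp_hom2[OF cs cd[OF that]] by (simp add: D3)
    show "inv2 C (FUnit A 1) \<cdot>\<^bsub>C\<^esub> FComp A cs0 (cd j) \<in> hom2 C (FMor A cs0 \<odot>\<^bsub>C\<^esub> FMor A (cd j)) (Id C (FOb A 1))"
      by (rule P.VComp_hom2[OF iu(2) c])
    show "invertible2 C (inv2 C (FUnit A 1) \<cdot>\<^bsub>C\<^esub> FComp A cs0 (cd j))"
      by (rule P.invertible2_VComp[OF iu(1) P.FComp_invertible[OF cs cd[OF that]] c iu(2)])
  qed
  have "nu1 C A \<in> hom2 C (FMor A cs0 \<odot>\<^bsub>C\<^esub> FMor A (cd 1)) (Id C (FOb A 1))" "invertible2 C (nu1 C A)"
    using \<nu>[of 1] by (simp_all add: nu1_def)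
  note \<mu> = P.invertible2_inv2(2)[OF this(2,1)]
  have \<nu>0: "nu0 C A \<in> hom2 C (FMor A cs0 \<odot>\<^bsub>C\<^esub> FMor A (cd 0)) (Id C (FOb A 1))"
    using \<nu>(1)[of 0] by (simp add: nu0_def)
  have \<sigma>s: "sigma01 C A \<in> hom2 C (FMor A (cD 1) \<odot>\<^bsub>C\<^esub> FMor A (cd 0)) (FMor A (cD 0) \<odot>\<^bsub>C\<^esub> FMor A (cd 0))"
    "sigma02 C A \<in> hom2 C (FMor A (cD 2) \<odot>\<^bsub>C\<^esub> FMor A (cd 0)) (FMor A (cD 0) \<odot>\<^bsub>C\<^esub> FMor A (cd 1))"
    "sigma12 C A \<in> hom2 C (FMor A (cD 2) \<odot>\<^bsub>C\<^esub> FMor A (cd 1)) (FMor A (cD 1) \<odot>\<^bsub>C\<^esub> FMor A (cd 1))"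
    unfolding sigma01_def sigma02_def sigma12_def by (rule \<sigma>[OF rel(1)] \<sigma>[OF rel(2)] \<sigma>[OF rel(3)]; simp)+
  have p: "FMor A (cd 0) \<in> hom C (FOb A 1) (FOb A 2)" "FMor A (cd 1) \<in> hom C (FOb A 1) (FOb A 2)"
    "FMor A (cD 0) \<in> hom C (FOb A 2) (FOb A 3)" "FMor A (cD 1) \<in> hom C (FOb A 2) (FOb A 3)"
    "FMor A (cD 2) \<in> hom C (FOb A 2) (FOb A 3)" "FMor A cs0 \<in> hom C (FOb A 2) (FOb A 1)"
    using P.FMor_hom cd cD cs by simp_all
  interpret S: descent_shape C "FMor A (cd 0)" "FMor A (cd 1)" "FMor A (cD 0)" "FMor A (cD 1)" "FMor A (cD 2)"
    "FMor A cs0" "sigma01 C A" "sigma02 C A" "sigma12 C A" "nu0 C A" "inv2 C (nu1 C A)"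
    by unfold_locales (use p \<sigma>s \<nu>0 \<mu> in \<open>simp_all add: hom_iff\<close>)
  have p0: "Dom C (FMor A (cd 0)) = FOb A 1" using p by (simp add: hom_iff)
  have datum: "descent_datum C A F \<beta> \<longleftrightarrow> S.datum F \<beta>" for F \<beta>
    using p0 P.FOb_Ob[OF one] by (auto simp: descent_datum_def S.datum_def hom2_iff simp del: One_nat_def)
  have d: "d \<in> Mor C" "Dom C d = L" "Cod C d = FOb A 1" "L \<in> Ob C"
    using L by (simp_all add: lax_descent_object_def hom_iff)
  show ?thesis
  proof (unfold_locales, goal_cases)
    case 1
    then show ?case using L by (simp add: lax_descent_object_def datum del: One_nat_def)
  next
    case (2 F \<beta>)
    then have "F \<in> hom C (Dom C F) (FOb A 1)" "Dom C F \<in> Ob C" "descent_datum C A F \<beta>"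
      by (simp_all add: datum S.datum_def hom_iff p0 del: One_nat_def)
    then show ?case using L d unfolding lax_descent_object_def by metis
  next
    case (3 F1 S F0 \<xi>)
    then have "S \<in> Ob C" using P.Dom_Ob by (auto simp: hom_iff)
    with 3 show ?case using L d unfolding lax_descent_object_def by blast
  qed
qed

theorem corollary2p5:
  fixes C :: "('o, 'm, 'c) pre2cat"
    and A :: "('o, 'm, 'c) Delta3_data"
    and L :: 'o and d :: 'm and \<psi> :: 'c
  assumes "two_category C"
    and "pseudofunctor Delta3 C A"
    and "lax_descent_object C A L d \<psi>"
  shows "creates_absolute_kan C d \<and>
    (\<forall>F E. F \<in> Mor C \<longrightarrow> equivalence C E \<longrightarrow>
       (Dom C E = Cod C d \<and> F = E \<odot>\<^bsub>C\<^esub> d) \<or> (Cod C E = Dom C d \<and> F = d \<odot>\<^bsub>C\<^esub> E) \<longrightarrow>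
       creates_absolute_kan C F)"
proof -
  note descent = lax_descent_object_imp_lax_descent[OF assms(2,3)]
  interpret C: two_category C by fact
  interpret co: two_category "co C" by (rule C.two_category_co)
  have d: "d \<in> Mor C"
    using lax_descent.d_simps(1)[OF descent] .
  have ran: "creates_absolute_ran C d"
    by (rule lax_descent.forgetful_creates_absolute_ran[OF descent])
  have lan: "creates_absolute_ran (co C) d"
    by (rule lax_descent.forgetful_creates_absolute_ran[OF lax_descent.lax_descent_co[OF descent]])
  have "creates_absolute_kan C (E \<odot>\<^bsub>C\<^esub> d)" if "equivalence C E" "Dom C E = Cod C d" for E
    using C.creates_absolute_ran_equivalence_Comp[OF ran d that]
      co.creates_absolute_ran_equivalence_Comp[OF lan _ C.equivalence_co[OF that(1)]] d that(2)
    by (simp add: creates_absolute_kan_def creates_absolute_lan_def)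
  moreover have "creates_absolute_kan C (d \<odot>\<^bsub>C\<^esub> E)" if "equivalence C E" "Cod C E = Dom C d" for E
    using C.creates_absolute_ran_Comp_equivalence[OF ran d that]
      co.creates_absolute_ran_Comp_equivalence[OF lan _ C.equivalence_co[OF that(1)]] d that(2)
    by (simp add: creates_absolute_kan_def creates_absolute_lan_def)
  ultimately show ?thesis
    using ran lan by (auto simp: creates_absolute_kan_def creates_absolute_lan_def)
qed

end
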